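(* Let $(\pi_n,\mu_n)$, $n\in\mathbb N$, and $(\pi,\mu)$ be $\square$-graphons on measurable spaces $(X_n,\mathcal A_n)$, $n\in\mathbb N$, and $(X,\mathcal A)$, respectively. Then the following conditions are equivalent: (a) for every $k\in\mathbb N$, the sequence $\big(\mathbb S_k(\pi_n,\mu_n)\big)_{n=1}^\infty$ is convergent (and its limit is $\mathbb S_k(\pi,\mu)$); (b) for every $k\in\mathbb N$, the sequence $\big(\widetilde{\mathbb S}_k(\pi_n,\mu_n)\big)_{n=1}^\infty$ is convergent (and its limit is $\widetilde{\mathbb S}_k(\pi,\mu)$). Here the equivalence is asserted both when the parenthetical clauses are included in (a) and (b), and when they are omitted from both (a) and (b).
   Context: A $\square$-graphon on a measurable space $(X,\mathcal A)$ is a pair $(\pi,\mu)$, where $\pi$ is a probability measure on $(X,\mathcal A)$ and $\mu$ is a finite measure on $(X,\mathcal A)^2=(X^2,\mathcal A^2)$, with $\mathcal A^2$ the product $\sigma$-algebra. A Markov kernel from $(X,\mathcal A)$ to $(Y,\mathcal B)$ is a map $\kappa\colon X\times\mathcal B\to[0,1]$ such that $\kappa(x,\cdot)$ is a probability measure on $(Y,\mathcal B)$ for every $x\in X$ and $\kappa(\cdot,B)$ is measurable for every $B\in\mathcal B$. The Markov kernel $\kappa^{\otimes 2}$ from $(X,\mathcal A)^2$ to $(Y,\mathcal B)^2$ is given by $\kappa^{\otimes 2}((x_1,x_2),\widetilde B)=(\kappa(x_1,\cdot)\times\kappa(x_2,\cdot))(\widetilde B)$ (product measure). For a measure $\pi$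 on $(X,\mathcal A)$, the pushforward along $\kappa$ is the measure $\kappa_*\pi(B)=\int_X\kappa(x,B)\,d\pi(x)$, $B\in\mathcal B$. A morphism from a $\square$-graphon $(\pi_X,\mu_X)$ on $(X,\mathcal A)$ to a $\square$-graphon $(\pi_Y,\mu_Y)$ on $(Y,\mathcal B)$ is a Markov kernel $\kappa$ from $(X,\mathcal A)$ to $(Y,\mathcal B)$ with $\kappa_*\pi_X=\pi_Y$ and $\kappa^{\otimes2}_*\mu_X=\mu_Y$. For $k\in\mathbb N$ let $[k]=\{1,\dots,k\}$ and $\mathcal F_k=([k],2^{[k]})$. The set of all $\square$-graphons $(\rho,\nu)$ on $\mathcal F_k$ is identified with a subset of $\mathbb R^{[k]\cup[k]^2}$ via the values $\rho(\{i\})$, $i\in[k]$, and $\nu(\{(i,j)\})$, $(i,j)\in[k]^2$, and carries the subspace topology. Similarly, the space of all finite measures on $\mathcal F_k^2$ is identified with a subspace of $\mathbb R^{[k]^2}$. For a $\square$-graphon $(\pi,\mu)$, $(\pi,\mu)^\downarrow_k$ is the set of all $\square$-graphons on $\mathcal F_k$ to which there is a morphism from $(\pi,\mu)$; $\mathbb S_k(\pi,\mu)$ is the closure of $(\pi,\mu)^\downarrow_k$ in the space of all $\square$-graphons on $\mathcal F_k$. Let $\gamma_k$ be the normalized counting measure on $\mathcal F_k$; $\widetilde{\mathbb S}_k(\pi,\mu)$ is the closure of $\{\nu:(\gamma_k,\nu)\in(\pi,\mu)^\downarrow_k\}$ in the space of all finite measures on $\mathcal F_k^2$. The sets $\mathbb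 S_k(\pi,\mu)$ and $\widetilde{\mathbb S}_k(\pi,\mu)$ are nonempty and compact. Convergence in (a) is in the Vietoris topology on the space of nonempty compact subsets of the space of all $\square$-graphons on $\mathcal F_k$; convergence in (b) is in the Vietoris topology on the space of nonempty compact subsets of the space of all finite measures on $\mathcal F_k^2$. *)

theory Defs
  imports "HOL-Probability.Probability"
begin

text \<open>
  A measurable space is represented, as usual in the library, by a value of type
  \<^typ>\<open>'a measure\<close> of which only \<^const>\<open>space\<close> and \<^const>\<open>sets\<close> are used.
\<close>

type_synonym 'a graphon = "'a measure \<times> ('a \<times> 'a) measure"

definition box_graphon :: "'a measure \<Rightarrow> 'a graphon \<Rightarrow> bool" where
  "box_graphon M = (\<lambda>(\<pi>, \<mu>).
     sets \<pi> = sets M \<and> prob_space \<pi> \<and>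
     sets \<mu> = sets (M \<Otimes>\<^sub>M M) \<and> finite_measure \<mu>)"

subsection \<open>Markov kernels and morphisms\<close>

definition markov_kernel :: "'a measure \<Rightarrow> 'b measure \<Rightarrow> ('a \<Rightarrow> 'b measure) \<Rightarrow> bool" where
  "markov_kernel M N \<kappa> \<longleftrightarrow> \<kappa> \<in> M \<rightarrow>\<^sub>M prob_algebra N"

lemma markov_kernel_iff:
  "markov_kernel M N \<kappa> \<longleftrightarrow>
     (\<forall>x\<in>space M. prob_space (\<kappa> x) \<and> sets (\<kappa> x) = sets N) \<and>
     (\<forall>B\<in>sets N. (\<lambda>x. measure (\<kappa> x) B) \<in> borel_measurable M)"
proof (intro iffI conjI ballI)
  assume "markov_kernel M N \<kappa>"
  then have k: "\<kappa> \<in> M \<rightarrow>\<^sub>M prob_algebra N" by (simp add: markov_kernel_def)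
  show "prob_space (\<kappa> x)" "sets (\<kappa> x) = sets N" if "x \<in> space M" for x
    using measurable_space[OF k that] by (auto simp: space_prob_algebra)
  show "(\<lambda>x. measure (\<kappa> x) B) \<in> borel_measurable M" if "B \<in> sets N" for B
    using measurable_compose[OF measurable_prob_algebraD[OF k]
        measurable_measure_subprob_algebra[OF that]] .
next
  assume *: "(\<forall>x\<in>space M. prob_space (\<kappa> x) \<and> sets (\<kappa> x) = sets N) \<and>
     (\<forall>B\<in>sets N. (\<lambda>x. measure (\<kappa> x) B) \<in> borel_measurable M)"
  have "\<kappa> \<in> M \<rightarrow>\<^sub>M subprob_algebra N"
  proof (rule measurable_subprob_algebra)
    show "subprob_space (\<kappa> a)" "sets (\<kappa> a) = sets N" if "a \<in> space M" for a
      using * that by (auto intro: prob_space_imp_subprob_space)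
    fix B assume B: "B \<in> sets N"
    have "(\<lambda>x. ennreal (measure (\<kappa> x) B)) \<in> borel_measurable M"
      using * B by auto
    moreover have "emeasure (\<kappa> x) B = ennreal (measure (\<kappa> x) B)" if "x \<in> space M" for x
    proof -
      interpret prob_space "\<kappa> x" using * that by auto
      show ?thesis by (rule emeasure_eq_measure)
    qed
    ultimately show "(\<lambda>a. emeasure (\<kappa> a) B) \<in> borel_measurable M"
      by (simp cong: measurable_cong)
  qed
  then show "markov_kernel M N \<kappa>"
    unfolding markov_kernel_def using * by (auto intro!: measurable_prob_algebraI)
qed

definition kernel_square :: "('a \<Rightarrow> 'b measure) \<Rightarrow> 'a \<times> 'a \<Rightarrow> ('b \<times> 'b) measure" where
  "kernel_square \<kappa> = (\<lambda>(x\<^sub>1, x\<^sub>2). \<kappa> x\<^sub>1 \<Otimes>\<^sub>M \<kappa> x\<^sub>2)"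

lemma markov_kernel_square:
  assumes "markov_kernel M N \<kappa>"
  shows "markov_kernel (M \<Otimes>\<^sub>M M) (N \<Otimes>\<^sub>M N) (kernel_square \<kappa>)"
proof -
  have [measurable]: "\<kappa> \<in> M \<rightarrow>\<^sub>M prob_algebra N"
    using assms by (simp add: markov_kernel_def)
  show ?thesis
    unfolding markov_kernel_def kernel_square_def split_beta' by measurable
qed

text \<open>The pushforward of a measure along a kernel is the monadic bind of the library.\<close>

lemma emeasure_bind_markov_kernel:
  assumes "markov_kernel M N \<kappa>" "sets \<pi> = sets M" "space M \<noteq> {}" "B \<in> sets N"
  shows "emeasure (\<pi> \<bind> \<kappa>) B = (\<integral>\<^sup>+ x. emeasure (\<kappa> x) B \<partial>\<pi>)"
proof (rule emeasure_bind)
  show "space \<pi> \<noteq> {}" using assms(2,3) sets_eq_imp_space_eq by metis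
  show "\<kappa> \<in> \<pi> \<rightarrow>\<^sub>M subprob_algebra N"
    using assms(1,2) by (simp add: markov_kernel_def measurable_prob_algebraD cong: measurable_cong_sets)
qed fact

definition box_morphism ::
  "'a measure \<Rightarrow> 'b measure \<Rightarrow> 'a graphon \<Rightarrow> 'b graphon \<Rightarrow> ('a \<Rightarrow> 'b measure) \<Rightarrow> bool" where
  "box_morphism M N = (\<lambda>(\<pi>, \<mu>) (\<rho>, \<nu>) \<kappa>.
     markov_kernel M N \<kappa> \<and> \<pi> \<bind> \<kappa> = \<rho> \<and> \<mu> \<bind> kernel_square \<kappa> = \<nu>)"

subsection \<open>Graphons on finite sets\<close>

definition fin_space :: "nat \<Rightarrow> nat measure" where
  "fin_space k = count_space {1..k}"

definition graphons_on :: "nat \<Rightarrow> nat graphon set" where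
  "graphons_on k = {G. box_graphon (fin_space k) G}"

definition finite_measures_on :: "nat \<Rightarrow> (nat \<times> nat) measure set" where
  "finite_measures_on k =
     {\<nu>. sets \<nu> = sets (fin_space k \<Otimes>\<^sub>M fin_space k) \<and> finite_measure \<nu>}"

text \<open>
  The identification with a subset of a finite power of the reals. The disjoint union of
  \<^term>\<open>{1..k}\<close> and its square is the index set; points of a power of the reals are
  functions that are \<^const>\<open>undefined\<close> off the index set, hence \<^const>\<open>restrict\<close>.
\<close>

definition graphon_coords :: "nat \<Rightarrow> nat graphon \<Rightarrow> nat + nat \<times> nat \<Rightarrow> real" where
  "graphon_coords k = (\<lambda>(\<rho>, \<nu>).
     restrict (case_sum (\<lambda>i. measure \<rho> {i}) (\<lambda>p. measure \<nu> {p}))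
       ({1..k} <+> {1..k} \<times> {1..k}))"

definition measure_coords :: "nat \<Rightarrow> (nat \<times> nat) measure \<Rightarrow> nat \<times> nat \<Rightarrow> real" where
  "measure_coords k \<nu> = restrict (\<lambda>p. measure \<nu> {p}) ({1..k} \<times> {1..k})"

definition graphon_topology :: "nat \<Rightarrow> nat graphon topology" where
  "graphon_topology k =
     pullback_topology (graphons_on k) (graphon_coords k)
       (powertop_real ({1..k} <+> {1..k} \<times> {1..k}))"

definition measure_topology :: "nat \<Rightarrow> (nat \<times> nat) measure topology" where
  "measure_topology k =
     pullback_topology (finite_measures_on k) (measure_coords k)
       (powertop_real ({1..k} \<times> {1..k}))"

lemma topspace_graphon_topology: "topspace (graphon_topology k) = graphons_on k"
  by (auto simp: graphon_topology_def topspace_pullback_topology graphon_coords_def)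

lemma topspace_measure_topology: "topspace (measure_topology k) = finite_measures_on k"
  by (auto simp: measure_topology_def topspace_pullback_topology measure_coords_def)

text \<open>The coordinates determine the measures, so both pullbacks are subspace topologies.\<close>

lemma inj_on_measure_coords: "inj_on (measure_coords k) (finite_measures_on k)"
proof (rule inj_onI)
  fix \<nu> \<nu>' assume *: "\<nu> \<in> finite_measures_on k" "\<nu>' \<in> finite_measures_on k"
    and eq: "measure_coords k \<nu> = measure_coords k \<nu>'"
  have sets: "sets (fin_space k \<Otimes>\<^sub>M fin_space k) = Pow ({1..k} \<times> {1..k})"
    unfolding fin_space_def by (subst pair_measure_countable) auto
  interpret \<nu>: finite_measure \<nu> using * by (simp add: finite_measures_on_def)
  interpret \<nu>': finite_measure \<nu>' using * by (simp add: finite_measures_on_def)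
  show "\<nu> = \<nu>'"
  proof (rule measure_eqI_finite[of _ "{1..k} \<times> {1..k}"])
    fix p assume "p \<in> {1..k} \<times> {1..k}"
    then show "emeasure \<nu> {p} = emeasure \<nu>' {p}"
      using fun_cong[OF eq, of p]
      by (simp add: measure_coords_def \<nu>.emeasure_eq_measure \<nu>'.emeasure_eq_measure)
  qed (use * sets in \<open>auto simp: finite_measures_on_def\<close>)
qed

lemma inj_on_graphon_coords: "inj_on (graphon_coords k) (graphons_on k)"
proof (rule inj_onI, clarify)
  fix \<rho> \<nu> \<rho>' \<nu>' assume *: "(\<rho>, \<nu>) \<in> graphons_on k" "(\<rho>', \<nu>') \<in> graphons_on k"
    and eq: "graphon_coords k (\<rho>, \<nu>) = graphon_coords k (\<rho>', \<nu>')"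
  have "measure_coords k \<nu> = measure_coords k \<nu>'"
  proof
    fix p show "measure_coords k \<nu> p = measure_coords k \<nu>' p"
      using fun_cong[OF eq, of "Inr p"]
      by (auto simp: graphon_coords_def measure_coords_def restrict_def split: if_splits)
  qed
  then have "\<nu> = \<nu>'"
    using inj_on_measure_coords[of k] *
    by (auto simp: inj_on_def graphons_on_def box_graphon_def finite_measures_on_def)
  moreover have "\<rho> = \<rho>'"
  proof (rule measure_eqI_finite[of _ "{1..k}"])
    interpret \<rho>: prob_space \<rho> using * by (simp add: graphons_on_def box_graphon_def)
    interpret \<rho>': prob_space \<rho>' using * by (simp add: graphons_on_def box_graphon_def)
    fix i assume "i \<in> {1..k}"
    then show "emeasure \<rho> {i} = emeasure \<rho>' {i}"
      using fun_cong[OF eq, of "Inl i"]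
      by (auto simp: graphon_coords_def Plus_def \<rho>.emeasure_eq_measure \<rho>'.emeasure_eq_measure)
  qed (use * in \<open>auto simp: graphons_on_def box_graphon_def fin_space_def\<close>)
  ultimately show "\<rho> = \<rho>' \<and> \<nu> = \<nu>'" by simp
qed

subsection \<open>The sets of quotients\<close>

definition down_set :: "nat \<Rightarrow> 'a measure \<Rightarrow> 'a graphon \<Rightarrow> nat graphon set" where
  "down_set k M G = {H \<in> graphons_on k. \<exists>\<kappa>. box_morphism M (fin_space k) G H \<kappa>}"

definition S_set :: "nat \<Rightarrow> 'a measure \<Rightarrow> 'a graphon \<Rightarrow> nat graphon set" where
  "S_set k M G = graphon_topology k closure_of down_set k M G"

definition S_tilde_set :: "nat \<Rightarrow> 'a measure \<Rightarrow> 'a graphon \<Rightarrow> (nat \<times> nat) measure set" where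
  "S_tilde_set k M G =
     measure_topology k closure_of {\<nu>. (uniform_count_measure {1..k}, \<nu>) \<in> down_set k M G}"

subsection \<open>The Vietoris topology\<close>

definition compact_subsets :: "'a topology \<Rightarrow> 'a set set" where
  "compact_subsets T = {K. compactin T K \<and> K \<noteq> {}}"

definition vietoris :: "'a topology \<Rightarrow> 'a set topology" where
  "vietoris T = topology_generated_by
     ({{K \<in> compact_subsets T. K \<subseteq> U} | U. openin T U} \<union>
      {{K \<in> compact_subsets T. K \<inter> U \<noteq> {}} | U. openin T U})"

lemma topspace_vietoris: "topspace (vietoris T) = compact_subsets T"
proof -
  have "{K \<in> compact_subsets T. K \<subseteq> topspace T} = compact_subsets T"
    by (auto simp: compact_subsets_def dest: compactin_subset_topspace)
  then show ?thesis
    unfolding vietoris_def topology_generated_by_topspace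
    by (intro equalityI Sup_least) (auto intro!: exI[of _ "topspace T"])
qed

definition vietoris_convergent :: "'a topology \<Rightarrow> (nat \<Rightarrow> 'a set) \<Rightarrow> bool" where
  "vietoris_convergent T K \<longleftrightarrow> (\<exists>L. limitin (vietoris T) K L sequentially)"

end

theory Submission
  imports Defs
begin

text \<open>
  A morphism to a graphon on \<open>{1..k}\<close> is a measurable partition of unity \<open>f\<^sub>1, \<dots>, f\<^sub>k\<close> on the
  source, and its target has the vertex weights \<open>\<integral> f\<^sub>i d\<pi>\<close> and the edge weights
  \<open>\<integral> f\<^sub>i(x) f\<^sub>j(y) d\<mu>(x, y)\<close> (\<open>morphism_imp_partition\<close>, \<open>partition_imp_down_set\<close>). Vietoris
  convergence of the compact sets in question is convergence for the Hausdorff distance, and,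
  because closed balls in the spaces of graphons and measures on finite sets are compact, the
  existence of a limit is the Cauchy property (\<open>vietoris_convergent_iff_Cauchy\<close>). Closures do not
  affect the Hausdorff distance. So the theorem follows once small Hausdorff distance between the
  quotient sets of two graphons forces small Hausdorff distance between their sets of quotients
  with uniform vertex weights, and conversely, with moduli that depend only on a bound for the
  total masses. Such a bound comes for free, since the total edge weight of a quotient is the
  mass of \<open>\<mu>\<close>.

  Both estimates use one device, \<open>adjust_vertex_weights\<close>: mixing a small constant vector into a
  partition of unity changes it by at most \<open>\<eta>\<close> \<^emph>\<open>uniformly\<close>, hence changes all vertex weights
  by at most \<open>\<eta>\<close> and all edge weights by at most \<open>2 \<eta> \<mu>(X\<^sup>2)\<close>, and it can turn the vertex weights \<open>w\<close>
  into any prescribed probability vector \<open>r \<ge> (1 - \<eta>) w\<close>. A uniform bound is essential,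
  as \<open>\<mu>\<close> need not be controlled by \<open>\<pi>\<close> and a part of small \<open>\<pi>\<close>-weight may carry large edge weights.

  From all quotients to uniform ones (\<open>near_uniform_slice\<close>): a quotient of the second graphon that
  is close to a quotient of the first with uniform weights has almost uniform weights, and
  mixing makes them uniform.

  From uniform quotients to all quotients (\<open>near_down_set\<close>): mixing makes the vertex weights of a
  given quotient on \<open>{1..m}\<close> equal to \<open>a\<^sub>1/k, \<dots>, a\<^sub>m/k\<close> with positive integers \<open>a\<^sub>i\<close>. Splitting
  the \<open>i\<close>-th function into \<open>a\<^sub>i\<close> equal pieces gives a quotient on \<open>{1..k}\<close> with uniform weights; a
  nearby uniform quotient of the other graphon is then merged along the same blocks. Merging does
  not increase the \<open>\<ell>\<^sup>1\<close>-distance of edge weights and gives the same vertex weights.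
\<close>

section \<open>Hausdorff distance and the Vietoris topology\<close>

definition near :: "('a \<Rightarrow> 'a \<Rightarrow> real) \<Rightarrow> real \<Rightarrow> 'a set \<Rightarrow> 'a set \<Rightarrow> bool" where
  "near d \<epsilon> A B \<longleftrightarrow> (\<forall>a\<in>A. \<exists>b\<in>B. d a b < \<epsilon>)"

text \<open>For bounded nonempty sets the infimum of these \<open>\<epsilon>\<close> is the Hausdorff distance; the relation
  also makes sense for sets that are not closed, such as the quotient sets before closure.\<close>

definition hausdorff_close :: "('a \<Rightarrow> 'a \<Rightarrow> real) \<Rightarrow> real \<Rightarrow> 'a set \<Rightarrow> 'a set \<Rightarrow> bool" where
  "hausdorff_close d \<epsilon> A B \<longleftrightarrow> near d \<epsilon> A B \<and> near d \<epsilon> B A"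

lemma nearD: "near d \<epsilon> A B \<Longrightarrow> a \<in> A \<Longrightarrow> \<exists>b\<in>B. d a b < \<epsilon>"
  by (simp add: near_def)

lemma near_mono: "near d \<epsilon> A B \<Longrightarrow> \<epsilon> \<le> \<epsilon>' \<Longrightarrow> near d \<epsilon>' A B"
  unfolding near_def by (meson less_le_trans)

lemma hausdorff_close_mono:
  "hausdorff_close d \<epsilon> A B \<Longrightarrow> \<epsilon> \<le> \<epsilon>' \<Longrightarrow> hausdorff_close d \<epsilon>' A B"
  unfolding hausdorff_close_def using near_mono by metis

context Metric_space
begin

lemma near_trans:
  assumes "near d \<epsilon> A B" "near d \<delta> B C" "A \<subseteq> M" "B \<subseteq> M" "C \<subseteq> M"
  shows "near d (\<epsilon> + \<delta>) A C"
  unfolding near_def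
proof
  fix a assume a: "a \<in> A"
  then obtain b where b: "b \<in> B" "d a b < \<epsilon>" using assms(1) nearD by metis
  then obtain c where c: "c \<in> C" "d b c < \<delta>" using assms(2) nearD by metis
  have "d a c \<le> d a b + d b c" using a b c assms by (intro triangle) auto
  with b c show "\<exists>c\<in>C. d a c < \<epsilon> + \<delta>" by force
qed

lemma hausdorff_close_trans:
  assumes "hausdorff_close d \<epsilon> A B" "hausdorff_close d \<delta> B C" "A \<subseteq> M" "B \<subseteq> M" "C \<subseteq> M"
  shows "hausdorff_close d (\<epsilon> + \<delta>) A C"
  using assms near_trans[of \<epsilon> A B \<delta> C] near_trans[of \<delta> C B \<epsilon> A]
  by (auto simp: hausdorff_close_def add.commute)

lemma hausdorff_close_closure_of:
  assumes "A \<subseteq> M" "\<epsilon> > 0"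
  shows "hausdorff_close d \<epsilon> A (mtopology closure_of A)"
proof -
  have "\<exists>b\<in>A. d a b < \<epsilon>" if "a \<in> mtopology closure_of A" for a
    using that assms(2) by (fastforce simp: metric_closure_of)
  moreover have "A \<subseteq> mtopology closure_of A"
    using assms(1) by (simp add: closure_of_subset)
  moreover have "d a a < \<epsilon>" if "a \<in> A" for a
    using that assms by auto
  ultimately show ?thesis
    unfolding hausdorff_close_def near_def by blast
qed

lemma hausdorff_close_commute: "hausdorff_close d \<epsilon> A B \<longleftrightarrow> hausdorff_close d \<epsilon> B A"
  by (auto simp: hausdorff_close_def)

lemma compact_subsets_subset: "K \<in> compact_subsets mtopology \<Longrightarrow> K \<subseteq> M"
  using compactin_subset_topspace[of mtopology K] by (simp add: compact_subsets_def)

lemma closure_of_in_compact_subsets: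
  assumes "compactin mtopology (mcball x r)" "A \<subseteq> mcball x r" "A \<noteq> {}"
  shows "mtopology closure_of A \<in> compact_subsets mtopology"
proof -
  have "mtopology closure_of A \<subseteq> mcball x r"
    using assms(2) by (simp add: closure_of_minimal)
  then have "compactin mtopology (mtopology closure_of A)"
    by (intro closed_compactin[OF assms(1)]) auto
  moreover have "A \<subseteq> mtopology closure_of A"
    using assms(2) mcball_subset_mspace by (intro closure_of_subset) auto
  ultimately show ?thesis using assms(3) by (auto simp: compact_subsets_def)
qed

text \<open>From left to right, the \<open>\<epsilon>\<close>-neighbourhood of \<open>L\<close> is an open superset of \<open>L\<close>, and the balls around
  a finite \<open>\<epsilon>/2\<close>-net of \<open>L\<close> are finitely many open sets that meet \<open>L\<close>. From right to left
  it suffices to treat subbasic open sets: a compact subset of an open set has an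
  \<open>\<epsilon>\<close>-neighbourhood inside that set, by the Lebesgue number lemma, and a
  point of \<open>L\<close> in an open set is approximated by points of the approximating sets.\<close>

lemma limitin_vietoris_iff:
  "limitin (vietoris mtopology) K L sequentially \<longleftrightarrow>
     L \<in> compact_subsets mtopology \<and>
     (\<forall>\<^sub>F n in sequentially. K n \<in> compact_subsets mtopology) \<and>
     (\<forall>\<epsilon>>0. \<forall>\<^sub>F n in sequentially. hausdorff_close d \<epsilon> (K n) L)"
    (is "?lhs \<longleftrightarrow> ?rhs")
proof
  assume lim: ?lhs
  then have L: "L \<in> compact_subsets mtopology"
    by (metis limitin_topspace topspace_vietoris)
  then have LM: "L \<subseteq> M" and Lc: "compactin mtopology L"
    by (simp_all add: compact_subsets_subset) (simp add: compact_subsets_def)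
  have nbhd: "\<forall>\<^sub>F n in sequentially. K n \<in> W" if "openin (vietoris mtopology) W" "L \<in> W" for W
    using lim that by (auto simp: limitin_def)
  have K: "\<forall>\<^sub>F n in sequentially. K n \<in> compact_subsets mtopology"
    using nbhd[OF openin_topspace] L by (simp add: topspace_vietoris)
  have "\<forall>\<^sub>F n in sequentially. hausdorff_close d \<epsilon> (K n) L" if \<epsilon>: "\<epsilon> > 0" for \<epsilon>
  proof -
    obtain F where F: "finite F" "F \<subseteq> L" "L \<subseteq> (\<Union>x\<in>F. mball x (\<epsilon>/2))"
      using compactin_imp_mtotally_bounded[OF Lc] \<epsilon> unfolding mtotally_bounded_def
      by (meson half_gt_zero)
    define U where "U = (\<Union>x\<in>L. mball x \<epsilon>)"
    have U: "openin mtopology U" "L \<subseteq> U"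
      using LM \<epsilon> by (auto simp: U_def)
    have upper: "\<forall>\<^sub>F n in sequentially. K n \<subseteq> U"
    proof -
      have "openin (vietoris mtopology) {A \<in> compact_subsets mtopology. A \<subseteq> U}"
        unfolding vietoris_def using U by (intro topology_generated_by_Basis) blast
      from nbhd[OF this] show ?thesis
        using L U by (auto elim: eventually_mono)
    qed
    have lower: "\<forall>\<^sub>F n in sequentially. \<forall>x\<in>F. K n \<inter> mball x (\<epsilon>/2) \<noteq> {}"
    proof (intro eventually_ball_finite F(1) ballI)
      fix x assume x: "x \<in> F"
      have "openin (vietoris mtopology) {A \<in> compact_subsets mtopology. A \<inter> mball x (\<epsilon>/2) \<noteq> {}}"
        unfolding vietoris_def by (intro topology_generated_by_Basis) blast
      moreover have "x \<in> L \<inter> mball x (\<epsilon>/2)"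
        using x F LM \<epsilon> by auto
      ultimately show "\<forall>\<^sub>F n in sequentially. K n \<inter> mball x (\<epsilon>/2) \<noteq> {}"
        using nbhd L by (fastforce elim: eventually_mono)
    qed
    from upper lower show ?thesis
    proof eventually_elim
      case (elim n)
      have "\<exists>b\<in>L. d a b < \<epsilon>" if "a \<in> K n" for a
        using elim(1) that commute by (fastforce simp: U_def)
      moreover have "\<exists>b\<in>K n. d a b < \<epsilon>" if a: "a \<in> L" for a
      proof -
        obtain x where x: "x \<in> F" "d x a < \<epsilon>/2" "x \<in> M" "a \<in> M" using F a by auto
        have "K n \<inter> mball x (\<epsilon>/2) \<noteq> {}" using elim(2) x(1) by blast
        then obtain b where b: "b \<in> K n" "d x b < \<epsilon>/2" "b \<in> M" by auto
        have "d a b \<le> d x a + d x b" using x b triangle'' commute by metis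
        with b x show ?thesis by force
      qed
      ultimately show ?case unfolding hausdorff_close_def near_def by blast
    qed
  qed
  with L K show ?rhs by blast
next
  assume rhs: ?rhs
  then have L: "L \<in> compact_subsets mtopology" and LM: "L \<subseteq> M" and Lc: "compactin mtopology L"
    by (simp_all add: compact_subsets_subset) (simp add: compact_subsets_def)
  have K: "\<forall>\<^sub>F n in sequentially. K n \<in> compact_subsets mtopology" using rhs by blast
  then have KM: "\<forall>\<^sub>F n in sequentially. K n \<subseteq> M"
    by eventually_elim (rule compact_subsets_subset)
  have "\<forall>\<^sub>F n in sequentially. K n \<in> W"
    if "generate_topology_on
     ({{K \<in> compact_subsets mtopology. K \<subseteq> U} | U. openin mtopology U} \<union>
      {{K \<in> compact_subsets mtopology. K \<inter> U \<noteq> {}} | U. openin mtopology U}) W" "L \<in> W" for W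
    using that
  proof induction
    case Empty
    then show ?case by simp
  next
    case (Int a b)
    then show ?case by (auto intro: eventually_conj)
  next
    case (UN \<W>)
    then obtain k where "k \<in> \<W>" "L \<in> k" by blast
    with UN.IH have "\<forall>\<^sub>F n in sequentially. K n \<in> k" by blast
    then show ?case using \<open>k \<in> \<W>\<close> by (auto elim: eventually_mono)
  next
    case (Basis s)
    then consider
        U where "openin mtopology U" "s = {K \<in> compact_subsets mtopology. K \<subseteq> U}" "L \<subseteq> U"
      | U where "openin mtopology U" "s = {K \<in> compact_subsets mtopology. K \<inter> U \<noteq> {}}" "L \<inter> U \<noteq> {}"
      by blast
    then show ?case
    proof cases
      case 1
      then obtain \<epsilon> where \<epsilon>: "\<epsilon> > 0" "\<And>x. x \<in> L \<Longrightarrow> mball x \<epsilon> \<subseteq> U"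
        using lebesgue_number[OF Lc, of "{U}"] by auto
      have "\<forall>\<^sub>F n in sequentially. hausdorff_close d \<epsilon> (K n) L" using rhs \<epsilon>(1) by blast
      with K KM show ?thesis
      proof eventually_elim
        case (elim n)
        have "x \<in> U" if x: "x \<in> K n" for x
        proof -
          obtain y where y: "y \<in> L" "d x y < \<epsilon>"
            using elim x by (auto simp: hausdorff_close_def dest: nearD)
          then have "x \<in> mball y \<epsilon>" using elim x LM commute by auto
          then show ?thesis using \<epsilon> y by blast
        qed
        then show ?case using elim 1 by blast
      qed
    next
      case 2
      then obtain x where x: "x \<in> L" "x \<in> U" by blast
      then obtain \<epsilon> where \<epsilon>: "\<epsilon> > 0" "mball x \<epsilon> \<subseteq> U"
        using 2 by (metis openin_mtopology)
      have "\<forall>\<^sub>F n in sequentially. hausdorff_close d \<epsilon> (K n) L" using rhs \<epsilon>(1) by blast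
      with K KM show ?thesis
      proof eventually_elim
        case (elim n)
        then obtain y where y: "y \<in> K n" "d x y < \<epsilon>"
          using x by (auto simp: hausdorff_close_def dest: nearD)
        then have "y \<in> mball x \<epsilon>" using elim LM x by auto
        then show ?case using elim 2 y \<epsilon> by blast
      qed
    qed
  qed
  with L show ?lhs
    unfolding limitin_def topspace_vietoris
    by (auto simp: vietoris_def openin_topology_generated_by_iff)
qed

text \<open>The limit of a Cauchy sequence is the set \<open>L\<close> of points that lie, for every \<open>j\<close>, in the
  closure of the union of the sets with index at least \<open>j\<close>. Compactness of balls makes it
  large enough: a point \<open>x\<close> of some late \<open>K n\<close> has points of all late \<open>K m\<close> within \<open>\<epsilon>\<close>, so a
  nested family of nonempty compact sets produces a point of \<open>L\<close> in the ball around \<open>x\<close>.\<close>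

lemma vietoris_convergent_iff_Cauchy:
  assumes proper: "\<And>x r. compactin mtopology (mcball x r)"
    and K: "\<And>n. K n \<in> compact_subsets mtopology"
  shows "vietoris_convergent mtopology K \<longleftrightarrow>
    (\<forall>\<epsilon>>0. \<exists>N. \<forall>m\<ge>N. \<forall>n\<ge>N. hausdorff_close d \<epsilon> (K m) (K n))"
    (is "_ \<longleftrightarrow> ?Cauchy")
proof
  have KM: "K n \<subseteq> M" for n
    using K by (rule compact_subsets_subset)
  assume "vietoris_convergent mtopology K"
  then obtain L where L: "limitin (vietoris mtopology) K L sequentially"
    by (auto simp: vietoris_convergent_def)
  then have LM: "L \<subseteq> M"
    by (simp add: limitin_vietoris_iff compact_subsets_subset)
  show ?Cauchy
  proof (intro allI impI)
    fix \<epsilon> :: real assume "\<epsilon> > 0"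
    then have "\<forall>\<^sub>F n in sequentially. hausdorff_close d (\<epsilon>/2) (K n) L"
      using L by (simp add: limitin_vietoris_iff)
    then obtain N where N: "\<And>n. n \<ge> N \<Longrightarrow> hausdorff_close d (\<epsilon>/2) (K n) L"
      by (auto simp: eventually_sequentially)
    have "hausdorff_close d \<epsilon> (K m) (K n)" if "m \<ge> N" "n \<ge> N" for m n
      using hausdorff_close_trans[OF N[OF that(1)] N[OF that(2), THEN hausdorff_close_commute[THEN iffD1]]
          KM LM KM] by simp
    then show "\<exists>N. \<forall>m\<ge>N. \<forall>n\<ge>N. hausdorff_close d \<epsilon> (K m) (K n)" by blast
  qed
next
  have KM: "K n \<subseteq> M" for n
    using K by (rule compact_subsets_subset)
  assume Cauchy: ?Cauchy
  define C where "C j = mtopology closure_of (\<Union>m\<in>{j..}. K m)" for j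
  define L where "L = (\<Inter>j. C j)"
  have C_closed: "closedin mtopology (C j)" for j
    by (simp add: C_def)
  have C_decr: "C j \<subseteq> C i" if "i \<le> j" for i j
    unfolding C_def using that by (intro closure_of_mono UN_mono) auto
  have KC: "K n \<subseteq> C j" if "j \<le> n" for n j
  proof -
    have "K n \<subseteq> (\<Union>m\<in>{j..}. K m)" using that by auto
    also have "\<dots> \<subseteq> C j" unfolding C_def using KM by (intro closure_of_subset) auto
    finally show ?thesis .
  qed
  \<comment> \<open>A point of the closure of the late union is near a late set, hence near every late set.\<close>
  have upper: "\<exists>y\<in>K n. d x y < 2 * \<epsilon>"
    if N: "\<And>m n. m \<ge> N \<Longrightarrow> n \<ge> N \<Longrightarrow> hausdorff_close d \<epsilon> (K m) (K n)" and n: "n \<ge> N" and x: "x \<in> C N" and "\<epsilon> > 0"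
    for n N x \<epsilon>
  proof -
    obtain z where z: "z \<in> M" "d x z < \<epsilon>" "z \<in> (\<Union>m\<in>{N..}. K m)"
      using x \<open>\<epsilon> > 0\<close> unfolding C_def metric_closure_of by force
    then obtain m where "m \<ge> N" "z \<in> K m" by auto
    then obtain y where y: "y \<in> K n" "d z y < \<epsilon>"
      using N[of m n] n by (auto simp: hausdorff_close_def dest: nearD)
    have "x \<in> M" using x C_closed closedin_subset by force
    then have "d x y \<le> d x z + d z y" using z y KM by (intro triangle) auto
    with y z show ?thesis by force
  qed
  have lower: "\<exists>y\<in>L. d x y \<le> \<epsilon>"
    if N: "\<And>m n. m \<ge> N \<Longrightarrow> n \<ge> N \<Longrightarrow> hausdorff_close d \<epsilon> (K m) (K n)" and n: "n \<ge> N" and x: "x \<in> K n"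
    for n N x \<epsilon>
  proof -
    have xM: "x \<in> M" using x KM by blast
    \<comment> \<open>The nested compact sets whose common point is the required point of \<open>L\<close>.\<close>
    define D where "D j = C (N + j) \<inter> mcball x \<epsilon>" for j
    have "(\<Inter>j. D j) \<noteq> {}"
    proof -
      have nest: "compact_space (subtopology mtopology (mcball x \<epsilon>))"
        using proper by (simp add: compact_space_subtopology)
      have "closedin (subtopology mtopology (mcball x \<epsilon>)) (D j)" for j
        using C_closed unfolding D_def closedin_subtopology by blast
      moreover have "D j \<noteq> {}" for j
      proof -
        obtain y where y: "y \<in> K (N + j)" "d x y < \<epsilon>"
          using N[of n "N + j"] n x by (auto simp: hausdorff_close_def dest: nearD)
        then have "y \<in> D j" using xM KM KC[of "N + j" "N + j"] by (auto simp: D_def)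
        then show ?thesis by blast
      qed
      moreover have "decseq D"
        unfolding decseq_def D_def using C_decr by (meson Int_mono add_left_mono order_refl)
      ultimately show ?thesis
        using compact_space_imp_nest[OF nest] by blast
    qed
    then obtain y where y: "\<And>j. y \<in> D j" by blast
    have "y \<in> C j" for j
      using y[of j] C_decr[of j "N + j"] by (auto simp: D_def)
    then show ?thesis using y[of 0] by (auto simp: L_def D_def)
  qed
  have close: "\<forall>\<^sub>F n in sequentially. hausdorff_close d \<epsilon> (K n) L" if "\<epsilon> > 0" for \<epsilon>
  proof -
    obtain N where N: "\<And>m n. m \<ge> N \<Longrightarrow> n \<ge> N \<Longrightarrow> hausdorff_close d (\<epsilon>/2) (K m) (K n)"
      using Cauchy \<open>\<epsilon> > 0\<close> by (meson half_gt_zero)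
    have "hausdorff_close d \<epsilon> (K n) L" if "n \<ge> N" for n
      unfolding hausdorff_close_def near_def
    proof (intro conjI ballI)
      fix a assume "a \<in> K n"
      from lower[OF N \<open>n \<ge> N\<close> this] obtain y where "y \<in> L" "d a y \<le> \<epsilon>/2" by auto
      then show "\<exists>b\<in>L. d a b < \<epsilon>" using \<open>\<epsilon> > 0\<close> by force
    next
      fix a assume "a \<in> L"
      then have "a \<in> C N" by (auto simp: L_def)
      from upper[OF N \<open>n \<ge> N\<close> this] show "\<exists>b\<in>K n. d a b < \<epsilon>" using \<open>\<epsilon> > 0\<close> by auto
    qed
    then show ?thesis by (auto simp: eventually_sequentially)
  qed
  have Lcl: "closedin mtopology L"
    unfolding L_def using C_closed by (intro closedin_Inter) auto
  have "compactin mtopology L \<and> L \<noteq> {}"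
  proof -
    obtain N where N: "hausdorff_close d 1 (K N) L"
      using close[of 1] by (auto simp: eventually_sequentially)
    have KN: "compactin mtopology (K N)" "K N \<noteq> {}"
      using K by (auto simp: compact_subsets_def)
    from compactin_imp_mbounded[OF KN(1)] obtain x B where B: "K N \<subseteq> mcball x B"
      by (auto simp: mbounded_def)
    have "L \<subseteq> mcball x (B + 1)"
    proof
      fix y assume y: "y \<in> L"
      then obtain z where z: "z \<in> K N" "d y z < 1"
        using N by (auto simp: hausdorff_close_def dest: nearD)
      have yM: "y \<in> M" using y Lcl closedin_subset by force
      have "d x y \<le> d x z + d y z"
        using z B yM by (intro triangle') (auto simp: commute)
      then show "y \<in> mcball x (B + 1)" using z B yM by force
    qed
    then have "compactin mtopology L"
      using closed_compactin[OF proper _ Lcl] by blast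
    moreover have "L \<noteq> {}"
      using N KN(2) by (auto simp: hausdorff_close_def near_def)
    ultimately show ?thesis ..
  qed
  then have "limitin (vietoris mtopology) K L sequentially"
    using K close by (simp add: limitin_vietoris_iff compact_subsets_def)
  then show "vietoris_convergent mtopology K"
    by (auto simp: vietoris_convergent_def)
qed


text \<open>A set and its closure are within every positive distance, so two triangle inequalities suffice.\<close>

lemma hausdorff_close_closures:
  assumes "A \<subseteq> M" "B \<subseteq> M" "\<epsilon> > 0"
  shows "hausdorff_close d (\<epsilon>/3) (mtopology closure_of A) (mtopology closure_of B) \<Longrightarrow> hausdorff_close d \<epsilon> A B"
    and "hausdorff_close d (\<epsilon>/3) A B \<Longrightarrow> hausdorff_close d \<epsilon> (mtopology closure_of A) (mtopology closure_of B)"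
proof -
  have [simp]: "mtopology closure_of S \<subseteq> M" for S
    using closure_of_subset_topspace[of mtopology S] by simp
  have \<epsilon>: "\<epsilon>/3 > 0" and \<epsilon>3: "\<epsilon>/3 + \<epsilon>/3 + \<epsilon>/3 = \<epsilon>" using assms(3) by auto
  note A = hausdorff_close_closure_of[OF assms(1) \<epsilon>]
  note B = hausdorff_close_closure_of[OF assms(2) \<epsilon>]
  show "hausdorff_close d \<epsilon> A B"
    if "hausdorff_close d (\<epsilon>/3) (mtopology closure_of A) (mtopology closure_of B)"
    using hausdorff_close_trans[OF hausdorff_close_trans[OF A that]
        B[THEN hausdorff_close_commute[THEN iffD1]]] assms
    unfolding \<epsilon>3 by simp
  show "hausdorff_close d \<epsilon> (mtopology closure_of A) (mtopology closure_of B)"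
    if "hausdorff_close d (\<epsilon>/3) A B"
    using hausdorff_close_trans[OF hausdorff_close_trans[OF
        A[THEN hausdorff_close_commute[THEN iffD1]] that] B] assms
    unfolding \<epsilon>3 by simp
qed

lemma limitin_vietoris_closures_iff:
  assumes A: "\<And>n. A n \<subseteq> M" "\<And>n. mtopology closure_of A n \<in> compact_subsets mtopology"
    and B: "B \<subseteq> M" "mtopology closure_of B \<in> compact_subsets mtopology"
  shows "limitin (vietoris mtopology) (\<lambda>n. mtopology closure_of A n) (mtopology closure_of B) sequentially
    \<longleftrightarrow> (\<forall>\<epsilon>>0. \<forall>\<^sub>F n in sequentially. hausdorff_close d \<epsilon> (A n) B)"
    (is "_ \<longleftrightarrow> ?R")
proof -
  have "(\<forall>\<epsilon>>0. \<forall>\<^sub>F n in sequentially. 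
      hausdorff_close d \<epsilon> (mtopology closure_of A n) (mtopology closure_of B)) \<longleftrightarrow> ?R"
  proof (intro iffI allI impI)
    fix \<epsilon> :: real assume "\<epsilon> > 0"
    then have *: "\<epsilon>/3 > 0" by simp
    show "\<forall>\<^sub>F n in sequentially. hausdorff_close d \<epsilon> (A n) B"
      if "\<forall>\<epsilon>>0. \<forall>\<^sub>F n in sequentially. 
        hausdorff_close d \<epsilon> (mtopology closure_of A n) (mtopology closure_of B)"
      using that[rule_format, OF *] hausdorff_close_closures(1)[OF A(1) B(1) \<open>\<epsilon> > 0\<close>]
      by (auto elim: eventually_mono)
    show "\<forall>\<^sub>F n in sequentially.
        hausdorff_close d \<epsilon> (mtopology closure_of A n) (mtopology closure_of B)"
      if ?R
      using that[rule_format, OF *] hausdorff_close_closures(2)[OF A(1) B(1) \<open>\<epsilon> > 0\<close>]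
      by (auto elim: eventually_mono)
  qed
  then show ?thesis using A B by (simp add: limitin_vietoris_iff)
qed

lemma vietoris_convergent_closures_iff:
  assumes proper: "\<And>x r. compactin mtopology (mcball x r)"
    and A: "\<And>n. A n \<subseteq> M" "\<And>n. mtopology closure_of A n \<in> compact_subsets mtopology"
  shows "vietoris_convergent mtopology (\<lambda>n. mtopology closure_of A n)
    \<longleftrightarrow> (\<forall>\<epsilon>>0. \<exists>N. \<forall>m\<ge>N. \<forall>n\<ge>N. hausdorff_close d \<epsilon> (A m) (A n))"
    (is "_ \<longleftrightarrow> ?R")
proof -
  have "(\<forall>\<epsilon>>0. \<exists>N. \<forall>m\<ge>N. \<forall>n\<ge>N.
      hausdorff_close d \<epsilon> (mtopology closure_of A m) (mtopology closure_of A n)) \<longleftrightarrow> ?R"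
  proof (intro iffI allI impI)
    fix \<epsilon> :: real assume "\<epsilon> > 0"
    then have *: "\<epsilon>/3 > 0" by simp
    show "\<exists>N. \<forall>m\<ge>N. \<forall>n\<ge>N. hausdorff_close d \<epsilon> (A m) (A n)"
      if "\<forall>\<epsilon>>0. \<exists>N. \<forall>m\<ge>N. \<forall>n\<ge>N.
        hausdorff_close d \<epsilon> (mtopology closure_of A m) (mtopology closure_of A n)"
      using that[rule_format, OF *] hausdorff_close_closures(1)[OF A(1) A(1) \<open>\<epsilon> > 0\<close>]
      by blast
    show "\<exists>N. \<forall>m\<ge>N. \<forall>n\<ge>N.
        hausdorff_close d \<epsilon> (mtopology closure_of A m) (mtopology closure_of A n)"
      if ?R
      using that[rule_format, OF *] hausdorff_close_closures(2)[OF A(1) A(1) \<open>\<epsilon> > 0\<close>]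
      by blast
  qed
  then show ?thesis using vietoris_convergent_iff_Cauchy[OF proper A(2)] by simp
qed
end

section \<open>The l1 metric of finitely many real coordinates\<close>

text \<open>The distance is pulled back along the coordinates \<open>c\<close>, so that it lives on the
  measures and graphons themselves.\<close>

definition l1_dist :: "'i set \<Rightarrow> ('a \<Rightarrow> 'i \<Rightarrow> real) \<Rightarrow> 'a \<Rightarrow> 'a \<Rightarrow> real" where
  "l1_dist I c x y = (\<Sum>i\<in>I. \<bar>c x i - c y i\<bar>)"

lemma Metric_space_l1_dist:
  assumes "finite I" "inj_on c S" "\<And>x. x \<in> S \<Longrightarrow> c x \<in> extensional I"
  shows "Metric_space S (l1_dist I c)"
proof
  fix x y z
  show "0 \<le> l1_dist I c x y" "l1_dist I c x y = l1_dist I c y x"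
    by (auto simp: l1_dist_def sum_nonneg abs_minus_commute)
  show "l1_dist I c x z \<le> l1_dist I c x y + l1_dist I c y z"
    unfolding l1_dist_def sum.distrib[symmetric] by (rule sum_mono) linarith
  assume xy: "x \<in> S" "y \<in> S"
  show "l1_dist I c x y = 0 \<longleftrightarrow> x = y"
  proof
    assume "l1_dist I c x y = 0"
    then have "\<forall>i\<in>I. c x i = c y i"
      using assms(1) by (simp add: l1_dist_def sum_nonneg_eq_0_iff)
    then have "c x = c y"
      using assms(3) xy by (intro extensionalityI[of _ I]) auto
    then show "x = y" using assms(2) xy by (auto dest: inj_onD)
  qed (simp add: l1_dist_def)
qed

lemma l1_dist_ge_coord: "finite I \<Longrightarrow> i \<in> I \<Longrightarrow> \<bar>c x i - c y i\<bar> \<le> l1_dist I c x y"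
  unfolding l1_dist_def by (rule member_le_sum) auto

lemma mtopology_l1_dist:
  fixes c :: "'a \<Rightarrow> 'i \<Rightarrow> real"
  assumes I: "finite I" and c: "inj_on c S" "\<And>x. x \<in> S \<Longrightarrow> c x \<in> extensional I"
  shows "Metric_space.mtopology S (l1_dist I c) = pullback_topology S c (powertop_real I)"
proof -
  interpret Metric_space S "l1_dist I c" by (rule Metric_space_l1_dist[OF assms])
  let ?P = "pullback_topology S c (powertop_real I)"
  have "openin mtopology U \<longleftrightarrow> openin ?P U" for U
  proof
    assume U: "openin ?P U"
    then obtain V where V: "openin (powertop_real I) V" "U = c -` V \<inter> S"
      by (auto simp: openin_pullback_topology)
    have "\<exists>r>0. mball x r \<subseteq> U" if x: "x \<in> U" for x
    proof -
      obtain B where B: "\<And>i. i \<in> I \<Longrightarrow> open (B i)" "c x \<in> Pi\<^sub>E I B" "Pi\<^sub>E I B \<subseteq> V"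
      proof -
        have "c x \<in> V" using V x by blast
        with V(1) obtain B where "\<forall>i\<in>I. openin euclideanreal (B i)" "c x \<in> Pi\<^sub>E I B" "Pi\<^sub>E I B \<subseteq> V"
          unfolding openin_product_topology_alt by blast
        then show ?thesis using that[of B] by simp
      qed
      have "\<exists>r>0. \<forall>t. \<bar>t - c x i\<bar> < r \<longrightarrow> t \<in> B i" if i: "i \<in> I" for i
        using B(1)[OF i] PiE_mem[OF B(2) i] by (auto simp: open_dist dist_real_def)
      then obtain r where r: "\<And>i. i \<in> I \<Longrightarrow> r i > 0"
          "\<And>i t. i \<in> I \<Longrightarrow> \<bar>t - c x i\<bar> < r i \<Longrightarrow> t \<in> B i" by metis
      define R where "R = Min (insert 1 (r ` I))"
      have R: "R > 0" "\<And>i. i \<in> I \<Longrightarrow> R \<le> r i" using I r(1) by (auto simp: R_def)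
      have "mball x R \<subseteq> U"
      proof
        fix y assume y: "y \<in> mball x R"
        have "c y i \<in> B i" if "i \<in> I" for i
        proof -
          have "\<bar>c y i - c x i\<bar> < R"
            using y l1_dist_ge_coord[OF I that, of c y x] by (simp add: commute)
          then show ?thesis using r(2) R(2) that by fastforce
        qed
        then have "c y \<in> Pi\<^sub>E I B" using c(2) y by (auto simp: PiE_iff)
        then show "y \<in> U" using B V y by auto
      qed
      then show ?thesis using R(1) by blast
    qed
    then show "openin mtopology U" using V by (auto simp: openin_mtopology)
  next
    assume U: "openin mtopology U"
    show "openin ?P U"
    proof (subst openin_subopen, intro ballI)
      fix x assume x: "x \<in> U"
      then have xS: "x \<in> S" using U openin_subset[OF U] by auto
      obtain r where r: "r > 0" "mball x r \<subseteq> U" using U x by (auto simp: openin_mtopology)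
      \<comment> \<open>The extra one keeps the sum strictly below \<open>r\<close> and covers an empty \<open>I\<close>.\<close>
      define s where "s = r / (card I + 1)"
      have s: "s > 0" using r by (simp add: s_def)
      define V where "V = Pi\<^sub>E I (\<lambda>i. {c x i - s<..<c x i + s})"
      have V: "openin (powertop_real I) V"
        unfolding V_def using I by (simp add: openin_PiE)
      have "c x \<in> V" using c(2)[OF xS] s by (auto simp: V_def PiE_iff)
      moreover have "y \<in> U" if y: "y \<in> S" "c y \<in> V" for y
      proof -
        have "l1_dist I c x y \<le> (\<Sum>i\<in>I. s)"
          unfolding l1_dist_def
        proof (rule sum_mono)
          fix i assume "i \<in> I"
          then have "c y i \<in> {c x i - s<..<c x i + s}" using y(2) PiE_mem unfolding V_def by fast
          then show "\<bar>c x i - c y i\<bar> \<le> s" by auto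
        qed
        also have "\<dots> < r" using r by (simp add: s_def field_simps)
        finally show ?thesis using r y xS by auto
      qed
      ultimately show "\<exists>T. openin ?P T \<and> x \<in> T \<and> T \<subseteq> U"
        using V xS by (intro exI[of _ "c -` V \<inter> S"]) (auto simp: openin_pullback_topology)
    qed
  qed
  then show ?thesis by (simp add: topology_eq)
qed

lemma compactin_pullback_topology:
  assumes "A \<subseteq> S" "compactin T (c ` A)"
  shows "compactin (pullback_topology S c T) A"
  unfolding compactin_def
proof (intro conjI allI impI)
  show "A \<subseteq> topspace (pullback_topology S c T)"
    using assms(1) compactin_subset_topspace[OF assms(2)] by (auto simp: topspace_pullback_topology)
  fix \<U> assume \<U>: "Ball \<U> (openin (pullback_topology S c T)) \<and> A \<subseteq> \<Union> \<U>"
  then have "\<forall>U\<in>\<U>. \<exists>V. openin T V \<and> U = c -` V \<inter> S"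
    by (auto simp: openin_pullback_topology)
  then obtain V where V: "\<And>U. U \<in> \<U> \<Longrightarrow> openin T (V U)" "\<And>U. U \<in> \<U> \<Longrightarrow> U = c -` V U \<inter> S"
    by metis
  have "c ` A \<subseteq> \<Union>(V ` \<U>)" using \<U> V(2) by blast
  then have "\<exists>\<F>. finite \<F> \<and> \<F> \<subseteq> V ` \<U> \<and> c ` A \<subseteq> \<Union>\<F>"
    using assms(2) V(1) unfolding compactin_def by (metis imageE)
  then obtain \<F> where \<F>: "finite \<F>" "\<F> \<subseteq> V ` \<U>" "c ` A \<subseteq> \<Union>\<F>" by blast
  then obtain \<G> where \<G>: "finite \<G>" "\<G> \<subseteq> \<U>" "\<F> = V ` \<G>"
    using finite_subset_image by metis
  have "A \<subseteq> \<Union>\<G>"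
  proof
    fix x assume x: "x \<in> A"
    then obtain U where "U \<in> \<G>" "c x \<in> V U" using \<F>(3) \<G>(3) by blast
    moreover from this have "U = c -` V U \<inter> S" using V(2) \<G>(2) by blast
    ultimately show "x \<in> \<Union>\<G>" using x assms(1) by blast
  qed
  then show "\<exists>\<F>. finite \<F> \<and> \<F> \<subseteq> \<U> \<and> A \<subseteq> \<Union> \<F>" using \<G> by blast
qed

text \<open>A ball lies in a box of coordinates, which is compact by Tychonoff's theorem and stays
  so after intersection with the closed image of the coordinate map.\<close>

lemma compactin_mcball_l1_dist:
  fixes c :: "'a \<Rightarrow> 'i \<Rightarrow> real"
  assumes I: "finite I" and c: "inj_on c S" "\<And>x. x \<in> S \<Longrightarrow> c x \<in> extensional I"
    and closed: "closedin (powertop_real I) (c ` S)"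
  shows "compactin (Metric_space.mtopology S (l1_dist I c)) (Metric_space.mcball S (l1_dist I c) x r)"
proof -
  interpret Metric_space S "l1_dist I c" by (rule Metric_space_l1_dist[OF I c])
  define B where "B = Pi\<^sub>E I (\<lambda>i. {c x i - r..c x i + r})"
  have "compactin (powertop_real I) (B \<inter> c ` S)"
    unfolding B_def using closed by (intro compact_Int_closedin) (auto simp: compactin_PiE)
  moreover have "B \<inter> c ` S = c ` (S \<inter> c -` B)" by auto
  ultimately have "compactin (pullback_topology S c (powertop_real I)) (S \<inter> c -` B)"
    by (intro compactin_pullback_topology) auto
  then have "compactin mtopology (S \<inter> c -` B)"
    by (simp only: mtopology_l1_dist[OF I c])
  moreover have "mcball x r \<subseteq> S \<inter> c -` B"
  proof
    fix y assume y: "y \<in> mcball x r"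
    have "c y i \<in> {c x i - r..c x i + r}" if "i \<in> I" for i
      using y l1_dist_ge_coord[OF I that, of c x y] by auto
    then show "y \<in> S \<inter> c -` B" using y c(2) by (auto simp: B_def PiE_iff)
  qed
  ultimately show ?thesis by (rule closed_compactin) simp
qed

section \<open>Quotients on finite sets as partitions of unity\<close>

text \<open>These are the Markov kernels to \<open>{1..k}\<close>, with \<open>f i x\<close> the probability of \<open>i\<close> from \<open>x\<close>.\<close>

definition measurable_partition :: "nat \<Rightarrow> 'a measure \<Rightarrow> (nat \<Rightarrow> 'a \<Rightarrow> real) \<Rightarrow> bool" where
  "measurable_partition k M f \<longleftrightarrow>
     (\<forall>i\<in>{1..k}. f i \<in> borel_measurable M) \<and>
     (\<forall>x\<in>space M. (\<forall>i\<in>{1..k}. 0 \<le> f i x) \<and> (\<Sum>i=1..k. f i x) = 1)"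

definition vertex_weight :: "'a graphon \<Rightarrow> (nat \<Rightarrow> 'a \<Rightarrow> real) \<Rightarrow> nat \<Rightarrow> real" where
  "vertex_weight G f i = (\<integral>x. f i x \<partial>fst G)"

definition edge_weight :: "'a graphon \<Rightarrow> (nat \<Rightarrow> 'a \<Rightarrow> real) \<Rightarrow> nat \<times> nat \<Rightarrow> real" where
  "edge_weight G f = (\<lambda>(i, j). \<integral>z. f i (fst z) * f j (snd z) \<partial>snd G)"

definition mass :: "'a graphon \<Rightarrow> real" where
  "mass G = measure (snd G) (space (snd G))"

lemma box_graphonD:
  assumes "box_graphon M G"
  shows "sets (fst G) = sets M" "prob_space (fst G)" "sets (snd G) = sets (M \<Otimes>\<^sub>M M)"
    "finite_measure (snd G)" "space (fst G) = space M" "space (snd G) = space M \<times> space M"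
    "space M \<noteq> {}"
proof -
  show 1: "sets (fst G) = sets M" "prob_space (fst G)" "sets (snd G) = sets (M \<Otimes>\<^sub>M M)"
    "finite_measure (snd G)"
    using assms by (auto simp: box_graphon_def split_beta)
  show 2: "space (fst G) = space M" using 1 sets_eq_imp_space_eq by blast
  show "space (snd G) = space M \<times> space M"
    using sets_eq_imp_space_eq[OF 1(3)] by (simp add: space_pair_measure)
  show "space M \<noteq> {}" using prob_space.not_empty[OF 1(2)] 2 by simp
qed

lemma sets_fin_space_square: "sets (fin_space k \<Otimes>\<^sub>M fin_space k) = Pow ({1..k} \<times> {1..k})"
  unfolding fin_space_def by (subst pair_measure_countable) auto

lemma sum_measure_singletons:
  assumes "finite_measure N" "sets N = Pow A" "finite A"
  shows "(\<Sum>a\<in>A. measure N {a}) = measure N (space N)"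
proof -
  interpret finite_measure N by fact
  have "space N = A" using assms(2) sets.top sets.space_closed by blast
  then show ?thesis
    using assms by (subst finite_measure_eq_sum_singleton) auto
qed

lemma measurable_partition_bounds:
  assumes "measurable_partition k M f" "x \<in> space M" "i \<in> {1..k}"
  shows "0 \<le> f i x" "f i x \<le> 1"
proof -
  show "0 \<le> f i x" using assms by (simp add: measurable_partition_def)
  have "f i x \<le> (\<Sum>i=1..k. f i x)"
    using assms by (intro member_le_sum) (auto simp: measurable_partition_def)
  then show "f i x \<le> 1" using assms by (simp add: measurable_partition_def)
qed

lemma integrable_partition:
  assumes "box_graphon M G" "measurable_partition k M f" "i \<in> {1..k}"
  shows "integrable (fst G) (f i)"
proof -
  note G = box_graphonD[OF assms(1)]
  interpret prob_space "fst G" by (rule G)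
  show ?thesis
  proof (rule integrable_const_bound[of _ 1])
    show "AE x in fst G. norm (f i x) \<le> 1"
      using measurable_partition_bounds[OF assms(2) _ assms(3)] G(5)
      by (intro AE_I2) (simp add: abs_of_nonneg)
    show "f i \<in> borel_measurable (fst G)"
      using assms G by (simp add: measurable_partition_def cong: measurable_cong_sets)
  qed
qed

lemma integrable_partition_square:
  assumes "box_graphon M G" "measurable_partition k M f" "i \<in> {1..k}" "measurable_partition l M g" "j \<in> {1..l}"
  shows "integrable (snd G) (\<lambda>z. f i (fst z) * g j (snd z))"
proof -
  note G = box_graphonD[OF assms(1)]
  interpret finite_measure "snd G" by (rule G)
  show ?thesis
  proof (rule integrable_const_bound[of _ 1])
    show "AE z in snd G. norm (f i (fst z) * g j (snd z)) \<le> 1"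
      using measurable_partition_bounds[OF assms(2) _ assms(3)]
        measurable_partition_bounds[OF assms(4) _ assms(5)] G(6)
      by (intro AE_I2) (auto simp: abs_mult intro!: mult_le_one)
    have [measurable]: "f i \<in> borel_measurable M" "g j \<in> borel_measurable M"
      using assms by (auto simp: measurable_partition_def)
    have "(\<lambda>z. f i (fst z) * g j (snd z)) \<in> borel_measurable (M \<Otimes>\<^sub>M M)" by measurable
    then show "(\<lambda>z. f i (fst z) * g j (snd z)) \<in> borel_measurable (snd G)"
      using G(3) by (simp cong: measurable_cong_sets)
  qed
qed

lemma vertex_weight_nonneg:
  assumes "box_graphon M G" "measurable_partition k M f" "i \<in> {1..k}"
  shows "vertex_weight G f i \<ge> 0"
  unfolding vertex_weight_def
  using measurable_partition_bounds[OF assms(2) _ assms(3)] box_graphonD(5)[OF assms(1)]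
  by (intro integral_nonneg_AE AE_I2) auto

lemma sum_vertex_weight:
  assumes "box_graphon M G" "measurable_partition k M f"
  shows "(\<Sum>i=1..k. vertex_weight G f i) = 1"
proof -
  note G = box_graphonD[OF assms(1)]
  interpret prob_space "fst G" by (rule G)
  have "(\<Sum>i=1..k. vertex_weight G f i) = (\<integral>x. (\<Sum>i=1..k. f i x) \<partial>fst G)"
    unfolding vertex_weight_def using integrable_partition[OF assms] by simp
  also have "\<dots> = (\<integral>x. 1 \<partial>fst G)"
    using assms(2) G(5) by (intro Bochner_Integration.integral_cong) (auto simp: measurable_partition_def)
  finally show ?thesis by (simp add: prob_space)
qed

definition partition_coords :: "nat \<Rightarrow> 'a graphon \<Rightarrow> (nat \<Rightarrow> 'a \<Rightarrow> real) \<Rightarrow> nat graphon \<Rightarrow> bool" where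
  "partition_coords k G f H \<longleftrightarrow>
     (\<forall>i\<in>{1..k}. measure (fst H) {i} = vertex_weight G f i) \<and>
     (\<forall>p\<in>{1..k} \<times> {1..k}. measure (snd H) {p} = edge_weight G f p)"

text \<open>The weights of the target are the integrals of \<open>\<kappa>(x, {i})\<close> and of
  \<open>(\<kappa>(x, \<cdot>) \<times> \<kappa>(y, \<cdot>)) {(i, j)} = \<kappa>(x, {i}) \<kappa>(y, {j})\<close>.\<close>

lemma morphism_imp_partition:
  assumes G: "box_graphon M G" and H: "box_morphism M (fin_space k) G H \<kappa>"
  shows "measurable_partition k M (\<lambda>i x. measure (\<kappa> x) {i})"
    "partition_coords k G (\<lambda>i x. measure (\<kappa> x) {i}) H"
proof -
  note G' = box_graphonD[OF G]
  have \<kappa>: "markov_kernel M (fin_space k) \<kappa>" and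
    H1: "fst H = fst G \<bind> \<kappa>" and H2: "snd H = snd G \<bind> kernel_square \<kappa>"
    using H by (auto simp: box_morphism_def split_beta)
  have \<kappa>x: "prob_space (\<kappa> x)" "sets (\<kappa> x) = sets (fin_space k)" "sets (\<kappa> x) = Pow {1..k}" if "x \<in> space M" for x
    using \<kappa> that by (auto simp: markov_kernel_iff fin_space_def)
  have em: "emeasure (\<kappa> x) B = ennreal (measure (\<kappa> x) B)" if "x \<in> space M" for x B
    using \<kappa>x(1)[OF that] by (simp add: prob_space_def finite_measure.emeasure_eq_measure)
  have meas: "(\<lambda>x. measure (\<kappa> x) {i}) \<in> borel_measurable M" if "i \<in> {1..k}" for i
    using \<kappa> that by (auto simp: markov_kernel_iff fin_space_def)
  show part: "measurable_partition k M (\<lambda>i x. measure (\<kappa> x) {i})"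
    unfolding measurable_partition_def
  proof (intro conjI ballI meas)
    fix x assume x: "x \<in> space M"
    interpret prob_space "\<kappa> x" using \<kappa>x x by simp
    show "(\<Sum>i=1..k. measure (\<kappa> x) {i}) = 1"
      using \<kappa>x[OF x] finite_measure_axioms by (simp add: sum_measure_singletons prob_space)
  qed (auto)
  have "measure (fst H) {i} = vertex_weight G (\<lambda>i x. measure (\<kappa> x) {i}) i" if i: "i \<in> {1..k}" for i
  proof -
    have "emeasure (fst H) {i} = (\<integral>\<^sup>+ x. emeasure (\<kappa> x) {i} \<partial>fst G)"
      unfolding H1 by (rule emeasure_bind_markov_kernel[OF \<kappa> G'(1,7)]) (use i in \<open>auto simp: fin_space_def\<close>)
    also have "\<dots> = (\<integral>\<^sup>+ x. ennreal (measure (\<kappa> x) {i}) \<partial>fst G)"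
      using em G'(5) by (intro nn_integral_cong) auto
    also have "\<dots> = ennreal (\<integral>x. measure (\<kappa> x) {i} \<partial>fst G)"
      using integrable_partition[OF G part i] by (intro nn_integral_eq_integral) auto
    finally show ?thesis
      by (simp add: vertex_weight_def measure_def integral_nonneg_AE)
  qed
  moreover have "measure (snd H) {p} = edge_weight G (\<lambda>i x. measure (\<kappa> x) {i}) p"
    if p: "p \<in> {1..k} \<times> {1..k}" for p
  proof -
    obtain i j where ij: "p = (i, j)" "i \<in> {1..k}" "j \<in> {1..k}" using p by auto
    have k2: "emeasure (kernel_square \<kappa> z) {p} =
        ennreal (measure (\<kappa> (fst z)) {i} * measure (\<kappa> (snd z)) {j})" if z: "z \<in> space M \<times> space M" for z
    proof -
      have x: "fst z \<in> space M" "snd z \<in> space M" using z by auto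
      interpret sigma_finite_measure "\<kappa> (snd z)"
        using \<kappa>x(1)[OF x(2)] by (simp add: prob_space_imp_sigma_finite)
      have "emeasure (kernel_square \<kappa> z) {p} = emeasure (\<kappa> (fst z) \<Otimes>\<^sub>M \<kappa> (snd z)) ({i} \<times> {j})"
        by (simp add: kernel_square_def split_beta ij)
      also have "\<dots> = emeasure (\<kappa> (fst z)) {i} * emeasure (\<kappa> (snd z)) {j}"
        using \<kappa>x(3)[OF x(1)] \<kappa>x(3)[OF x(2)] ij by (intro emeasure_pair_measure_Times) auto
      finally show ?thesis using em x by (simp add: ennreal_mult)
    qed
    have "emeasure (snd H) {p} = (\<integral>\<^sup>+ z. emeasure (kernel_square \<kappa> z) {p} \<partial>snd G)"
      unfolding H2 by (rule emeasure_bind_markov_kernel[OF markov_kernel_square[OF \<kappa>] G'(3)])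
       (use p G'(7) in \<open>auto simp: space_pair_measure sets_fin_space_square\<close>)
    also have "\<dots> = (\<integral>\<^sup>+ z. ennreal (measure (\<kappa> (fst z)) {i} * measure (\<kappa> (snd z)) {j}) \<partial>snd G)"
      using k2 G'(6) by (intro nn_integral_cong) auto
    also have "\<dots> = ennreal (\<integral>z. measure (\<kappa> (fst z)) {i} * measure (\<kappa> (snd z)) {j} \<partial>snd G)"
      using integrable_partition_square[OF G part ij(2) part ij(3)] by (intro nn_integral_eq_integral) auto
    finally show ?thesis
      by (simp add: edge_weight_def ij measure_def integral_nonneg_AE)
  qed
  ultimately show "partition_coords k G (\<lambda>i x. measure (\<kappa> x) {i}) H"
    by (simp add: partition_coords_def)
qed

lemma down_setE:
  assumes "box_graphon M G" "H \<in> down_set k M G"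
  obtains f where "measurable_partition k M f" "partition_coords k G f H"
  using assms morphism_imp_partition unfolding down_set_def by blast

lemma bind_kernel_in_down_set:
  assumes G: "box_graphon M G" and \<kappa>: "markov_kernel M (fin_space k) \<kappa>"
  shows "(fst G \<bind> \<kappa>, snd G \<bind> kernel_square \<kappa>) \<in> down_set k M G"
proof -
  note G' = box_graphonD[OF G]
  note \<kappa>2 = markov_kernel_square[OF \<kappa>]
  have space_ne: "space (fst G) \<noteq> {}" "space (snd G) \<noteq> {}" using G' by auto
  have sets1: "sets (fst G \<bind> \<kappa>) = sets (fin_space k)"
    using \<kappa> G'(5) space_ne by (intro sets_bind) (auto simp: markov_kernel_iff)
  have sets2: "sets (snd G \<bind> kernel_square \<kappa>) = sets (fin_space k \<Otimes>\<^sub>M fin_space k)"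
    using \<kappa>2 G'(6) space_ne by (intro sets_bind) (auto simp: markov_kernel_iff space_pair_measure)
  have "prob_space (fst G \<bind> \<kappa>)"
  proof
    have "emeasure (fst G \<bind> \<kappa>) (space (fin_space k)) = (\<integral>\<^sup>+ x. emeasure (\<kappa> x) (space (fin_space k)) \<partial>fst G)"
      by (rule emeasure_bind_markov_kernel[OF \<kappa> G'(1,7)]) auto
    also have "\<dots> = (\<integral>\<^sup>+ x. 1 \<partial>fst G)"
    proof (rule nn_integral_cong)
      fix x assume "x \<in> space (fst G)"
      then have "prob_space (\<kappa> x)" "space (\<kappa> x) = space (fin_space k)"
        using \<kappa> G'(5) sets_eq_imp_space_eq unfolding markov_kernel_iff by metis+
      then show "emeasure (\<kappa> x) (space (fin_space k)) = 1" using prob_space.emeasure_space_1 by metis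
    qed
    also have "\<dots> = 1" using prob_space.emeasure_space_1[OF G'(2)] by simp
    finally show "emeasure (fst G \<bind> \<kappa>) (space (fst G \<bind> \<kappa>)) = 1"
      using sets_eq_imp_space_eq[OF sets1] by simp
  qed
  moreover have "finite_measure (snd G \<bind> kernel_square \<kappa>)"
  proof
    let ?S = "space (fin_space k \<Otimes>\<^sub>M fin_space k)"
    have "emeasure (snd G \<bind> kernel_square \<kappa>) ?S = (\<integral>\<^sup>+ x. emeasure (kernel_square \<kappa> x) ?S \<partial>snd G)"
      by (rule emeasure_bind_markov_kernel[OF \<kappa>2 G'(3)]) (use G'(7) in \<open>auto simp: space_pair_measure\<close>)
    also have "\<dots> \<le> (\<integral>\<^sup>+ x. 1 \<partial>snd G)"
    proof (rule nn_integral_mono)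
      fix x assume "x \<in> space (snd G)"
      then have "prob_space (kernel_square \<kappa> x)"
        using \<kappa>2 G'(6) unfolding markov_kernel_iff by (auto simp: space_pair_measure)
      then show "emeasure (kernel_square \<kappa> x) ?S \<le> 1"
        by (intro subprob_space.subprob_emeasure_le_1 prob_space_imp_subprob_space)
    qed
    also have "\<dots> < \<infinity>" using finite_measure.emeasure_finite[OF G'(4)] by (simp add: less_top)
    finally show "emeasure (snd G \<bind> kernel_square \<kappa>) (space (snd G \<bind> kernel_square \<kappa>)) \<noteq> \<infinity>"
      using sets_eq_imp_space_eq[OF sets2] by simp
  qed
  ultimately show ?thesis
    using \<kappa> sets1 sets2
    by (auto simp: down_set_def graphons_on_def box_graphon_def box_morphism_def split_beta)
qed

lemma partition_imp_down_set:
  assumes G: "box_graphon M G" and f: "measurable_partition k M f"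
  obtains H where "H \<in> down_set k M G" "partition_coords k G f H"
proof -
  define \<kappa> where "\<kappa> x = point_measure {1..k} (\<lambda>i. ennreal (f i x))" for x
  have f0: "0 \<le> f i x" if "i \<in> {1..k}" "x \<in> space M" for i x
    using f that by (simp add: measurable_partition_def)
  have em: "emeasure (\<kappa> x) B = ennreal (\<Sum>i\<in>B. f i x)" if "x \<in> space M" "B \<subseteq> {1..k}" for x B
    using that f0 unfolding \<kappa>_def
    by (subst emeasure_point_measure_finite) (auto intro!: sum_ennreal)
  have me: "measure (\<kappa> x) B = (\<Sum>i\<in>B. f i x)" if "x \<in> space M" "B \<subseteq> {1..k}" for x B
    using em[OF that] f0 that by (auto simp: measure_def intro!: enn2real_ennreal sum_nonneg)
  have \<kappa>: "markov_kernel M (fin_space k) \<kappa>"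
    unfolding markov_kernel_iff
  proof (intro conjI ballI)
    fix x assume x: "x \<in> space M"
    show "sets (\<kappa> x) = sets (fin_space k)" by (simp add: \<kappa>_def fin_space_def sets_point_measure)
    show "prob_space (\<kappa> x)"
      using em[OF x, of "{1..k}"] x f
      by (intro prob_spaceI) (simp add: \<kappa>_def space_point_measure measurable_partition_def)
  next
    fix B assume "B \<in> sets (fin_space k)"
    then have B: "B \<subseteq> {1..k}" by (simp add: fin_space_def)
    have "(\<lambda>x. \<Sum>i\<in>B. f i x) \<in> borel_measurable M"
      using f B by (intro borel_measurable_sum) (auto simp: measurable_partition_def)
    then show "(\<lambda>x. measure (\<kappa> x) B) \<in> borel_measurable M"
      using me B by (simp cong: measurable_cong)
  qed
  let ?H = "(fst G \<bind> \<kappa>, snd G \<bind> kernel_square \<kappa>)"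
  have "box_morphism M (fin_space k) G ?H \<kappa>"
    using \<kappa> by (simp add: box_morphism_def split_beta)
  from morphism_imp_partition(2)[OF G this]
  have "partition_coords k G (\<lambda>i x. measure (\<kappa> x) {i}) ?H" .
  moreover have "vertex_weight G (\<lambda>i x. measure (\<kappa> x) {i}) i = vertex_weight G f i" if "i \<in> {1..k}" for i
    unfolding vertex_weight_def using me that box_graphonD(5)[OF G]
    by (intro Bochner_Integration.integral_cong) auto
  moreover have "edge_weight G (\<lambda>i x. measure (\<kappa> x) {i}) p = edge_weight G f p" if "p \<in> {1..k} \<times> {1..k}" for p
    unfolding edge_weight_def split_beta using me that box_graphonD(6)[OF G]
    by (intro Bochner_Integration.integral_cong) auto
  ultimately have "partition_coords k G f ?H" by (simp add: partition_coords_def)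
  with bind_kernel_in_down_set[OF G \<kappa>] show thesis by (rule that)
qed

section \<open>The spaces of graphons and measures on a finite set\<close>

definition graphon_dist :: "nat \<Rightarrow> nat graphon \<Rightarrow> nat graphon \<Rightarrow> real" where
  "graphon_dist k = l1_dist ({1..k} <+> {1..k} \<times> {1..k}) (graphon_coords k)"

definition measure_dist :: "nat \<Rightarrow> (nat \<times> nat) measure \<Rightarrow> (nat \<times> nat) measure \<Rightarrow> real" where
  "measure_dist k = l1_dist ({1..k} \<times> {1..k}) (measure_coords k)"

lemma measure_dist_eq:
  "measure_dist k \<nu> \<nu>' = (\<Sum>p\<in>{1..k} \<times> {1..k}. \<bar>measure \<nu> {p} - measure \<nu>' {p}\<bar>)"
  by (simp add: measure_dist_def l1_dist_def measure_coords_def)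

lemma graphon_dist_eq:
  "graphon_dist k H H' = (\<Sum>i=1..k. \<bar>measure (fst H) {i} - measure (fst H') {i}\<bar>) +
     (\<Sum>p\<in>{1..k} \<times> {1..k}. \<bar>measure (snd H) {p} - measure (snd H') {p}\<bar>)"
  unfolding graphon_dist_def l1_dist_def
  by (subst sum.Plus) (simp_all add: graphon_coords_def split_beta comp_def InlI InrI)

lemma graphon_coords_extensional: "graphon_coords k H \<in> extensional ({1..k} <+> {1..k} \<times> {1..k})"
  by (simp add: graphon_coords_def split_beta)

lemma measure_coords_extensional: "measure_coords k \<nu> \<in> extensional ({1..k} \<times> {1..k})"
  by (simp add: measure_coords_def)

interpretation graphons: Metric_space "graphons_on k" "graphon_dist k" for k
  unfolding graphon_dist_def
  by (rule Metric_space_l1_dist[OF _ inj_on_graphon_coords graphon_coords_extensional]) simp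

interpretation measures: Metric_space "finite_measures_on k" "measure_dist k" for k
  unfolding measure_dist_def
  by (rule Metric_space_l1_dist[OF _ inj_on_measure_coords measure_coords_extensional]) simp

lemma mtopology_graphons: "graphons.mtopology k = graphon_topology k"
  unfolding graphon_dist_def graphon_topology_def
  by (rule mtopology_l1_dist[OF _ inj_on_graphon_coords graphon_coords_extensional]) simp

lemma mtopology_measures: "measures.mtopology k = measure_topology k"
  unfolding measure_dist_def measure_topology_def
  by (rule mtopology_l1_dist[OF _ inj_on_measure_coords measure_coords_extensional]) simp

lemma finite_measure_from_weights:
  fixes w :: "nat \<times> nat \<Rightarrow> real"
  assumes "\<And>p. p \<in> {1..k} \<times> {1..k} \<Longrightarrow> 0 \<le> w p"
  obtains \<nu> where "\<nu> \<in> finite_measures_on k" "\<And>p. p \<in> {1..k} \<times> {1..k} \<Longrightarrow> measure \<nu> {p} = w p"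
proof
  let ?\<nu> = "point_measure ({1..k} \<times> {1..k}) (\<lambda>p. ennreal (w p))"
  have "finite_measure ?\<nu>"
    by (rule finite_measureI) (simp add: space_point_measure emeasure_point_measure_finite)
  then show "?\<nu> \<in> finite_measures_on k"
    by (simp only: finite_measures_on_def sets_fin_space_square sets_point_measure mem_Collect_eq simp_thms)
  show "measure ?\<nu> {p} = w p" if "p \<in> {1..k} \<times> {1..k}" for p
    using that assms[OF that] by (auto simp: measure_def emeasure_point_measure_finite)
qed

lemma prob_space_from_weights:
  fixes w :: "nat \<Rightarrow> real"
  assumes "\<And>i. i \<in> {1..k} \<Longrightarrow> 0 \<le> w i" "(\<Sum>i=1..k. w i) = 1"
  obtains \<rho> where "sets \<rho> = sets (fin_space k)" "prob_space \<rho>" "\<And>i. i \<in> {1..k} \<Longrightarrow> measure \<rho> {i} = w i"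
proof
  let ?\<rho> = "point_measure {1..k} (\<lambda>p. ennreal (w p))"
  show "sets ?\<rho> = sets (fin_space k)" by (simp add: fin_space_def sets_point_measure)
  show "prob_space ?\<rho>"
    using assms sum_ennreal[of "{1..k}" w]
    by (intro prob_spaceI) (simp add: space_point_measure emeasure_point_measure_finite)
  show "measure ?\<rho> {i} = w i" if "i \<in> {1..k}" for i
    using that assms(1)[OF that] by (auto simp: measure_def emeasure_point_measure_finite)
qed

lemma closedin_powertop_nonneg:
  fixes I :: "'i set"
  shows "closedin (powertop_real I) {y \<in> extensional I. \<forall>i\<in>I. 0 \<le> y i}"
proof -
  have "{y \<in> extensional I. \<forall>i\<in>I. 0 \<le> y i} = Pi\<^sub>E I (\<lambda>i. {0::real..})"
    by (auto simp: PiE_iff extensional_def)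
  then show ?thesis by (simp add: closedin_product_topology)
qed

lemma measure_coords_image:
  "measure_coords k ` finite_measures_on k =
     {y \<in> extensional ({1..k} \<times> {1..k}). \<forall>p\<in>{1..k} \<times> {1..k}. 0 \<le> y p}" (is "_ = ?R")
proof (intro equalityI subsetI)
  fix y assume y: "y \<in> ?R"
  from y obtain \<nu> where \<nu>: "\<nu> \<in> finite_measures_on k" "\<And>p. p \<in> {1..k} \<times> {1..k} \<Longrightarrow> measure \<nu> {p} = y p"
    using finite_measure_from_weights[of k y] by auto
  have "measure_coords k \<nu> = y"
    using \<nu>(2) y by (intro extensionalityI[of _ "{1..k} \<times> {1..k}"]) (auto simp: measure_coords_def)
  then show "y \<in> measure_coords k ` finite_measures_on k" using \<nu>(1) by blast
qed (auto simp: measure_coords_def)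

text \<open>In coordinates, graphons are cut out by nonnegativity and the linear equation that the vertex
  weights sum to one; both conditions are closed, which makes balls of graphons compact.\<close>

lemma graphon_coords_image:
  "graphon_coords k ` graphons_on k =
     {y \<in> extensional ({1..k} <+> {1..k} \<times> {1..k}). \<forall>i\<in>{1..k} <+> {1..k} \<times> {1..k}. 0 \<le> y i} \<inter>
     {y \<in> topspace (powertop_real ({1..k} <+> {1..k} \<times> {1..k})). (\<Sum>i=1..k. y (Inl i)) \<in> {1}}" (is "_ = ?R \<inter> ?S")
proof (intro equalityI subsetI)
  fix y assume "y \<in> ?R \<inter> ?S"
  then have y: "y \<in> extensional ({1..k} <+> {1..k} \<times> {1..k})" "\<And>i. i \<in> {1..k} \<Longrightarrow> 0 \<le> y (Inl i)"
    "\<And>p. p \<in> {1..k} \<times> {1..k} \<Longrightarrow> 0 \<le> y (Inr p)" "(\<Sum>i=1..k. y (Inl i)) = 1"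
    by (auto simp del: atLeastAtMost_iff)
  obtain \<nu> where \<nu>: "\<nu> \<in> finite_measures_on k" "\<And>p. p \<in> {1..k} \<times> {1..k} \<Longrightarrow> measure \<nu> {p} = y (Inr p)"
    using finite_measure_from_weights[of k "\<lambda>p. y (Inr p)"] y by metis
  obtain \<rho> where \<rho>: "sets \<rho> = sets (fin_space k)" "prob_space \<rho>" "\<And>i. i \<in> {1..k} \<Longrightarrow> measure \<rho> {i} = y (Inl i)"
    using prob_space_from_weights[of k "\<lambda>i. y (Inl i)"] y by metis
  have "graphon_coords k (\<rho>, \<nu>) = y"
  proof (rule extensionalityI[OF graphon_coords_extensional y(1)])
    fix i assume "i \<in> {1..k} <+> {1..k} \<times> {1..k}"
    then show "graphon_coords k (\<rho>, \<nu>) i = y i"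
      using \<rho>(3) \<nu>(2) by (auto simp: graphon_coords_def)
  qed
  moreover have "(\<rho>, \<nu>) \<in> graphons_on k"
    using \<rho> \<nu> by (auto simp: graphons_on_def box_graphon_def finite_measures_on_def)
  ultimately show "y \<in> graphon_coords k ` graphons_on k" by blast
next
  fix y assume "y \<in> graphon_coords k ` graphons_on k"
  then obtain H where H: "H \<in> graphons_on k" "y = graphon_coords k H" by blast
  have sets: "sets (fst H) = sets (fin_space k)" and "prob_space (fst H)"
    using H by (auto simp: graphons_on_def box_graphon_def)
  then interpret prob_space "fst H" by simp
  have "(\<Sum>i=1..k. y (Inl i)) = (\<Sum>i=1..k. measure (fst H) {i})"
    by (intro sum.cong) (auto simp: H(2) graphon_coords_def split_beta)
  also have "\<dots> = 1"
    using sets finite_measure_axioms by (subst sum_measure_singletons) (auto simp: fin_space_def prob_space)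
  finally show "y \<in> ?R \<inter> ?S"
    using graphon_coords_extensional[of k H] by (auto simp: H(2) graphon_coords_def split_beta PiE_iff)
qed

lemma compactin_mcball_measures: "compactin (measure_topology k) (measures.mcball k \<nu> r)"
  unfolding mtopology_measures[symmetric] measure_dist_def
  by (rule compactin_mcball_l1_dist[OF _ inj_on_measure_coords measure_coords_extensional])
    (simp_all only: measure_coords_image closedin_powertop_nonneg finite_atLeastAtMost finite_cartesian_product)

lemma compactin_mcball_graphons: "compactin (graphon_topology k) (graphons.mcball k H r)"
  unfolding mtopology_graphons[symmetric] graphon_dist_def
proof (rule compactin_mcball_l1_dist[OF _ inj_on_graphon_coords graphon_coords_extensional])
  show "closedin (powertop_real ({1..k} <+> {1..k} \<times> {1..k})) (graphon_coords k ` graphons_on k)"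
    unfolding graphon_coords_image
    by (intro closedin_Int closedin_powertop_nonneg closedin_continuous_map_preimage[where Y=euclideanreal]
        continuous_map_sum continuous_map_product_projection) auto
qed simp

section \<open>Dependence of the weights on the partition\<close>

text \<open>Pointwise, \<open>\<Sum>\<^sub>i\<^sub>j f\<^sub>i(x) f\<^sub>j(y) = (\<Sum>\<^sub>i f\<^sub>i(x)) (\<Sum>\<^sub>j f\<^sub>j(y)) = 1\<close>. The mass of \<open>\<mu>\<close> can thus be
  read off from any quotient.\<close>

lemma sum_edge_weight:
  assumes G: "box_graphon M G" and f: "measurable_partition k M f"
  shows "(\<Sum>p\<in>{1..k} \<times> {1..k}. edge_weight G f p) = mass G"
proof -
  note G' = box_graphonD[OF G]
  interpret finite_measure "snd G" by (rule G')
  have "(\<Sum>p\<in>{1..k} \<times> {1..k}. edge_weight G f p) =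
      (\<Sum>p\<in>{1..k} \<times> {1..k}. \<integral>z. f (fst p) (fst z) * f (snd p) (snd z) \<partial>snd G)"
    unfolding edge_weight_def case_prod_unfold by (rule refl)
  also have "\<dots> = (\<integral>z. (\<Sum>p\<in>{1..k} \<times> {1..k}. f (fst p) (fst z) * f (snd p) (snd z)) \<partial>snd G)"
    by (rule Bochner_Integration.integral_sum[symmetric])
      (auto intro!: integrable_partition_square[OF G f _ f] simp del: One_nat_def)
  also have "\<dots> = (\<integral>z. 1 \<partial>snd G)"
  proof (rule Bochner_Integration.integral_cong)
    fix z assume "z \<in> space (snd G)"
    then have z: "fst z \<in> space M" "snd z \<in> space M" by (simp_all add: G'(6) mem_Times_iff)
    have "(\<Sum>p\<in>{1..k} \<times> {1..k}. f (fst p) (fst z) * f (snd p) (snd z)) =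
        (\<Sum>i=1..k. f i (fst z)) * (\<Sum>j=1..k. f j (snd z))"
      by (simp only: sum_product sum.cartesian_product case_prod_unfold)
    then show "(\<Sum>p\<in>{1..k} \<times> {1..k}. f (fst p) (fst z) * f (snd p) (snd z)) = 1"
      using f z by (simp add: measurable_partition_def)
  qed simp
  also have "\<dots> = mass G" by (simp add: mass_def)
  finally show ?thesis .
qed

lemma mass_nonneg: "mass G \<ge> 0"
  by (simp add: mass_def)

text \<open>Since all values lie in \<open>[0, 1]\<close>, the products differ by at most \<open>2 \<eta>\<close> at each point. As
  this holds everywhere, it can be integrated against \<open>\<mu>\<close>, whatever its relation to \<open>\<pi>\<close>.\<close>

lemma edge_weight_close:
  assumes G: "box_graphon M G" and f: "measurable_partition k M f" and g: "measurable_partition k M g"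
    and close: "\<And>i x. i \<in> {1..k} \<Longrightarrow> x \<in> space M \<Longrightarrow> \<bar>f i x - g i x\<bar> \<le> \<eta>"
    and p: "p \<in> {1..k} \<times> {1..k}"
  shows "\<bar>edge_weight G f p - edge_weight G g p\<bar> \<le> 2 * \<eta> * mass G"
proof -
  note G' = box_graphonD[OF G]
  interpret finite_measure "snd G" by (rule G')
  obtain i j where ij: "p = (i, j)" "i \<in> {1..k}" "j \<in> {1..k}" using p by auto
  let ?F = "\<lambda>z. f i (fst z) * f j (snd z)" and ?G = "\<lambda>z. g i (fst z) * g j (snd z)"
  have F: "integrable (snd G) ?F" and H: "integrable (snd G) ?G"
    using integrable_partition_square[OF G f ij(2) f ij(3)] integrable_partition_square[OF G g ij(2) g ij(3)]
    by auto
  have bound: "\<bar>?F z - ?G z\<bar> \<le> 2 * \<eta>" if "z \<in> space (snd G)" for z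
  proof -
    have z: "fst z \<in> space M" "snd z \<in> space M" using that by (simp_all add: G'(6) mem_Times_iff)
    have "?F z - ?G z = (f i (fst z) - g i (fst z)) * f j (snd z) + g i (fst z) * (f j (snd z) - g j (snd z))"
      by (simp add: algebra_simps)
    also have "\<bar>\<dots>\<bar> \<le> \<bar>f i (fst z) - g i (fst z)\<bar> * \<bar>f j (snd z)\<bar> + \<bar>g i (fst z)\<bar> * \<bar>f j (snd z) - g j (snd z)\<bar>"
      unfolding abs_mult[symmetric] by (rule abs_triangle_ineq)
    also have "\<dots> \<le> \<eta> * 1 + 1 * \<eta>"
      using measurable_partition_bounds[OF f z(2) ij(3)] measurable_partition_bounds[OF g z(1) ij(2)]
        close[OF ij(2) z(1)] close[OF ij(3) z(2)]
      by (intro add_mono mult_mono) auto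
    finally show ?thesis by simp
  qed
  have "\<bar>edge_weight G f p - edge_weight G g p\<bar> = \<bar>\<integral>z. ?F z - ?G z \<partial>snd G\<bar>"
    using F H by (simp add: edge_weight_def ij)
  also have "\<dots> \<le> (\<integral>z. \<bar>?F z - ?G z\<bar> \<partial>snd G)" by (rule integral_abs_bound)
  also have "\<dots> \<le> (\<integral>z. 2 * \<eta> \<partial>snd G)"
    using F H bound by (intro integral_mono) auto
  finally show ?thesis by (simp add: mass_def mult.commute)
qed

lemma vertex_weight_close:
  assumes G: "box_graphon M G" and f: "measurable_partition k M f" and g: "measurable_partition k M g"
    and close: "\<And>i x. i \<in> {1..k} \<Longrightarrow> x \<in> space M \<Longrightarrow> \<bar>f i x - g i x\<bar> \<le> \<eta>"
    and i: "i \<in> {1..k}"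
  shows "\<bar>vertex_weight G f i - vertex_weight G g i\<bar> \<le> \<eta>"
proof -
  note G' = box_graphonD[OF G]
  interpret prob_space "fst G" by (rule G')
  note F = integrable_partition[OF G f i] and H = integrable_partition[OF G g i]
  have "\<bar>vertex_weight G f i - vertex_weight G g i\<bar> = \<bar>\<integral>z. f i z - g i z \<partial>fst G\<bar>"
    using F H by (simp add: vertex_weight_def)
  also have "\<dots> \<le> (\<integral>z. \<bar>f i z - g i z\<bar> \<partial>fst G)" by (rule integral_abs_bound)
  also have "\<dots> \<le> (\<integral>z. \<eta> \<partial>fst G)"
    using F H close[OF i] G'(5) by (intro integral_mono) auto
  finally show ?thesis by (simp add: prob_space)
qed

text \<open>Put \<open>g\<^sub>i = (1 - \<eta>) f\<^sub>i + s\<^sub>i\<close> with the constants \<open>s\<^sub>i = r\<^sub>i - (1 - \<eta>) w\<^sub>i\<close>, where \<open>w\<close> is the vector of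
  vertex weights of \<open>f\<close>. The hypothesis on \<open>r\<close> says that \<open>s\<^sub>i \<ge> 0\<close>; as the \<open>s\<^sub>i\<close> sum to \<open>\<eta>\<close>, both \<open>s\<^sub>i\<close>
  and \<open>\<eta> f\<^sub>i\<close> lie in \<open>[0, \<eta>]\<close>, and \<open>g\<^sub>i\<close> differs from \<open>f\<^sub>i\<close> by their difference.\<close>

lemma adjust_vertex_weights:
  assumes G: "box_graphon M G" and f: "measurable_partition k M f"
    and \<eta>: "0 \<le> \<eta>" "\<eta> \<le> 1"
    and r: "\<And>i. i \<in> {1..k} \<Longrightarrow> (1 - \<eta>) * vertex_weight G f i \<le> r i" "(\<Sum>i=1..k. r i) = 1"
  obtains g where "measurable_partition k M g"
    "\<And>i. i \<in> {1..k} \<Longrightarrow> vertex_weight G g i = r i"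
    "\<And>i x. i \<in> {1..k} \<Longrightarrow> x \<in> space M \<Longrightarrow> \<bar>f i x - g i x\<bar> \<le> \<eta>"
proof -
  note G' = box_graphonD[OF G]
  interpret prob_space "fst G" by (rule G')
  define s where "s i = r i - (1 - \<eta>) * vertex_weight G f i" for i
  define g where "g i x = (1 - \<eta>) * f i x + s i" for i x
  have s0: "0 \<le> s i" if "i \<in> {1..k}" for i using r(1)[OF that] by (simp add: s_def)
  have s_sum: "(\<Sum>i=1..k. s i) = \<eta>"
    using r(2) sum_vertex_weight[OF G f]
    by (simp add: s_def sum_subtractf sum_distrib_left[symmetric])
  have s1: "s i \<le> \<eta>" if "i \<in> {1..k}" for i
    unfolding s_sum[symmetric] using s0 that by (intro member_le_sum) auto
  have "measurable_partition k M g"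
    unfolding measurable_partition_def
  proof (intro conjI ballI)
    fix i assume "i \<in> {1..k}"
    then have [measurable]: "f i \<in> borel_measurable M" using f by (simp add: measurable_partition_def)
    show "g i \<in> borel_measurable M" unfolding g_def by measurable
  next
    fix x i assume "x \<in> space M" "i \<in> {1..k}"
    then show "0 \<le> g i x"
      using measurable_partition_bounds[OF f] s0 \<eta> by (simp add: g_def)
  next
    fix x assume "x \<in> space M"
    then show "(\<Sum>i=1..k. g i x) = 1"
      using f s_sum by (simp add: g_def sum.distrib sum_distrib_left[symmetric] measurable_partition_def)
  qed
  moreover have "vertex_weight G g i = r i" if "i \<in> {1..k}" for i
    using integrable_partition[OF G f that] by (simp add: vertex_weight_def g_def s_def prob_space)
  moreover have "\<bar>f i x - g i x\<bar> \<le> \<eta>" if "i \<in> {1..k}" "x \<in> space M" for i x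
  proof -
    have "f i x - g i x = \<eta> * f i x - s i" by (simp add: g_def algebra_simps)
    moreover have "0 \<le> \<eta> * f i x" "\<eta> * f i x \<le> \<eta>"
      using measurable_partition_bounds[OF f that(2,1)] \<eta> by (auto simp: mult_left_le)
    ultimately show ?thesis using s0[OF that(1)] s1[OF that(1)] by linarith
  qed
  ultimately show thesis by (rule that)
qed

text \<open>The set whose closure is \<^const>\<open>S_tilde_set\<close>.\<close>

definition uniform_slice :: "nat \<Rightarrow> 'a measure \<Rightarrow> 'a graphon \<Rightarrow> (nat \<times> nat) measure set" where
  "uniform_slice k M G = {\<nu>. (uniform_count_measure {1..k}, \<nu>) \<in> down_set k M G}"

lemma down_set_subset: "down_set k M G \<subseteq> graphons_on k"
  by (auto simp: down_set_def)

lemma uniform_slice_subset: "uniform_slice k M G \<subseteq> finite_measures_on k"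
  by (auto simp: uniform_slice_def down_set_def graphons_on_def box_graphon_def finite_measures_on_def)

lemma measure_uniform_singleton: "i \<in> {1..k} \<Longrightarrow> measure (uniform_count_measure {1..k}) {i} = 1 / real k"
  by (subst measure_uniform_count_measure) auto

lemma uniform_slice_imp_partition:
  assumes "box_graphon M G" "\<nu> \<in> uniform_slice k M G"
  obtains f where "measurable_partition k M f" "\<And>i. i \<in> {1..k} \<Longrightarrow> vertex_weight G f i = 1 / real k"
    "\<And>p. p \<in> {1..k} \<times> {1..k} \<Longrightarrow> measure \<nu> {p} = edge_weight G f p"
proof -
  obtain f where "measurable_partition k M f" "partition_coords k G f (uniform_count_measure {1..k}, \<nu>)"
    using assms down_setE unfolding uniform_slice_def by blast
  then show thesis using measure_uniform_singleton that[of f] by (auto simp: partition_coords_def simp del: One_nat_def)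
qed

lemma partition_imp_uniform_slice:
  assumes G: "box_graphon M G" and f: "measurable_partition k M f" "\<And>i. i \<in> {1..k} \<Longrightarrow> vertex_weight G f i = 1 / real k"
  obtains \<nu> where "\<nu> \<in> uniform_slice k M G"
    "\<And>p. p \<in> {1..k} \<times> {1..k} \<Longrightarrow> measure \<nu> {p} = edge_weight G f p"
proof -
  obtain H where H: "H \<in> down_set k M G" "partition_coords k G f H"
    using partition_imp_down_set[OF G f(1)] by blast
  have "sets (fst H) = Pow {1..k}" and "prob_space (fst H)"
    using H(1) by (auto simp: down_set_def graphons_on_def box_graphon_def fin_space_def)
  then interpret prob_space "fst H" by simp
  have "{1..k} \<noteq> {}" using sum_vertex_weight[OF G f(1)] by (metis sum.empty zero_neq_one)
  then interpret u: prob_space "uniform_count_measure {1..k}" by (intro prob_space_uniform_count_measure) auto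
  have "fst H = uniform_count_measure {1..k}"
  proof (rule measure_eqI_finite[of _ "{1..k}"])
    fix i assume i: "i \<in> {1..k}"
    have "measure (fst H) {i} = measure (uniform_count_measure {1..k}) {i}"
      unfolding measure_uniform_singleton[OF i] using H(2) f(2) i by (simp add: partition_coords_def)
    then show "emeasure (fst H) {i} = emeasure (uniform_count_measure {1..k}) {i}"
      by (simp only: emeasure_eq_measure u.emeasure_eq_measure)
  qed (auto simp: \<open>sets (fst H) = Pow {1..k}\<close> sets_uniform_count_measure)
  then have "(uniform_count_measure {1..k}, snd H) = H" by (metis prod.collapse)
  then have "snd H \<in> uniform_slice k M G" using H(1) by (simp only: uniform_slice_def mem_Collect_eq)
  then show thesis using H(2) that by (auto simp: partition_coords_def simp del: One_nat_def)
qed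

section \<open>The closed quotient sets are compact\<close>

lemma sum_down_set:
  assumes "box_graphon M G" "H \<in> down_set k M G"
  shows "(\<Sum>i=1..k. measure (fst H) {i}) = 1" "(\<Sum>p\<in>{1..k} \<times> {1..k}. measure (snd H) {p}) = mass G"
proof -
  obtain f where f: "measurable_partition k M f" "partition_coords k G f H"
    using down_setE[OF assms] .
  have "(\<Sum>i=1..k. measure (fst H) {i}) = (\<Sum>i=1..k. vertex_weight G f i)"
    using f(2) by (intro sum.cong) (auto simp: partition_coords_def)
  then show "(\<Sum>i=1..k. measure (fst H) {i}) = 1"
    using sum_vertex_weight[OF assms(1) f(1)] by simp
  have "(\<Sum>p\<in>{1..k} \<times> {1..k}. measure (snd H) {p}) = (\<Sum>p\<in>{1..k} \<times> {1..k}. edge_weight G f p)"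
    using f(2) unfolding partition_coords_def by (intro sum.cong) blast+
  then show "(\<Sum>p\<in>{1..k} \<times> {1..k}. measure (snd H) {p}) = mass G"
    using sum_edge_weight[OF assms(1) f(1)] by simp
qed

lemma sum_uniform_slice:
  assumes "box_graphon M G" "\<nu> \<in> uniform_slice k M G"
  shows "(\<Sum>p\<in>{1..k} \<times> {1..k}. measure \<nu> {p}) = mass G"
  using sum_down_set(2)[OF assms(1), of "(uniform_count_measure {1..k}, \<nu>)"] assms(2)
  by (simp add: uniform_slice_def)

lemma uniform_slice_nonempty:
  assumes "box_graphon M G" "k \<ge> 1"
  shows "uniform_slice k M G \<noteq> {}"
proof -
  interpret prob_space "fst G" using box_graphonD[OF assms(1)] by simp
  have "measurable_partition k M (\<lambda>_ _. 1 / real k)"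
    using assms(2) by (simp add: measurable_partition_def)
  moreover have "vertex_weight G (\<lambda>_ _. 1 / real k) i = 1 / real k" for i
    by (simp add: vertex_weight_def prob_space)
  ultimately show ?thesis
    using partition_imp_uniform_slice[OF assms(1)] by (metis empty_iff)
qed

lemma down_set_nonempty:
  assumes "box_graphon M G" "k \<ge> 1"
  shows "down_set k M G \<noteq> {}"
  using uniform_slice_nonempty[OF assms] by (auto simp: uniform_slice_def)

lemma sum_abs_diff_le:
  fixes x y :: "'i \<Rightarrow> real"
  assumes "\<And>i. i \<in> I \<Longrightarrow> 0 \<le> x i" "\<And>i. i \<in> I \<Longrightarrow> 0 \<le> y i"
  shows "(\<Sum>i\<in>I. \<bar>x i - y i\<bar>) \<le> sum x I + sum y I"
  unfolding sum.distrib[symmetric] using assms by (intro sum_mono) (smt (verit))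

text \<open>All quotients have the same total vertex weight and the same total edge weight, hence they
  form a bounded set.\<close>

lemma S_set_compact:
  assumes G: "box_graphon M G" and k: "k \<ge> 1"
  shows "S_set k M G \<in> compact_subsets (graphon_topology k)"
proof -
  obtain H where H: "H \<in> down_set k M G" using down_set_nonempty[OF G k] by blast
  have "down_set k M G \<subseteq> graphons.mcball k H (2 + 2 * mass G)"
  proof
    fix H' assume H': "H' \<in> down_set k M G"
    have "graphon_dist k H H' \<le> (1 + 1) + (mass G + mass G)"
      unfolding graphon_dist_eq sum_down_set(1)[OF G H, symmetric] sum_down_set(2)[OF G H, symmetric]
      using sum_abs_diff_le[of "{1..k}" "\<lambda>i. measure (fst H) {i}" "\<lambda>i. measure (fst H') {i}"]
        sum_abs_diff_le[of "{1..k} \<times> {1..k}" "\<lambda>p. measure (snd H) {p}" "\<lambda>p. measure (snd H') {p}"]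
        sum_down_set[OF G H] sum_down_set[OF G H']
      by simp
    then show "H' \<in> graphons.mcball k H (2 + 2 * mass G)"
      using subsetD[OF down_set_subset H] subsetD[OF down_set_subset H'] by simp
  qed
  then show ?thesis
    unfolding S_set_def mtopology_graphons[symmetric] using H
    by (intro graphons.closure_of_in_compact_subsets compactin_mcball_graphons[folded mtopology_graphons]) auto
qed

lemma S_tilde_set_compact:
  assumes G: "box_graphon M G" and k: "k \<ge> 1"
  shows "S_tilde_set k M G \<in> compact_subsets (measure_topology k)"
proof -
  obtain \<nu> where \<nu>: "\<nu> \<in> uniform_slice k M G" using uniform_slice_nonempty[OF G k] by blast
  have "uniform_slice k M G \<subseteq> measures.mcball k \<nu> (2 * mass G)"
  proof
    fix \<nu>' assume \<nu>': "\<nu>' \<in> uniform_slice k M G"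
    have "measure_dist k \<nu> \<nu>' \<le> 2 * mass G"
      using sum_abs_diff_le[of "{1..k} \<times> {1..k}" "\<lambda>p. measure \<nu> {p}" "\<lambda>p. measure \<nu>' {p}"]
        sum_uniform_slice[OF G \<nu>] sum_uniform_slice[OF G \<nu>']
      by (simp add: measure_dist_eq)
    then show "\<nu>' \<in> measures.mcball k \<nu> (2 * mass G)"
      using subsetD[OF uniform_slice_subset \<nu>] subsetD[OF uniform_slice_subset \<nu>'] by simp
  qed
  then show ?thesis
    unfolding S_tilde_set_def uniform_slice_def[symmetric] mtopology_measures[symmetric] using \<nu>
    by (intro measures.closure_of_in_compact_subsets compactin_mcball_measures[folded mtopology_measures]) auto
qed


section \<open>From all quotients to uniform quotients\<close>

text \<open>If every vertex weight is at most \<open>1/k + \<delta>\<close>, then the uniform weights dominate \<open>1 - \<eta>\<close> times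
  the given ones for \<open>1 - \<eta> = 1/(1 + k \<delta>)\<close>. Mixing thus costs \<open>\<eta> \<le> k \<delta>\<close>, that is, at most
  \<open>2 k \<delta> C\<close> for each of the \<open>k\<^sup>2\<close> edge weights.\<close>

lemma near_uniform_slice:
  assumes G: "box_graphon M G" and G': "box_graphon M' G'" and k: "k \<ge> 1" and \<delta>: "\<delta> > 0"
    and C: "mass G' \<le> C" and near: "near (graphon_dist k) \<delta> (down_set k M G) (down_set k M' G')"
  shows "near (measure_dist k) (\<delta> + 2 * real k ^ 3 * \<delta> * C) (uniform_slice k M G) (uniform_slice k M' G')"
  unfolding near_def
proof
  fix \<nu> assume "\<nu> \<in> uniform_slice k M G"
  then have "(uniform_count_measure {1..k}, \<nu>) \<in> down_set k M G" by (simp add: uniform_slice_def)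
  then obtain H where H: "H \<in> down_set k M' G'"
    and "graphon_dist k (uniform_count_measure {1..k}, \<nu>) H < \<delta>"
    using near nearD by metis
  then have dist: "(\<Sum>i=1..k. \<bar>1 / real k - measure (fst H) {i}\<bar>) +
      (\<Sum>p\<in>{1..k} \<times> {1..k}. \<bar>measure \<nu> {p} - measure (snd H) {p}\<bar>) < \<delta>"
    using measure_uniform_singleton by (simp add: graphon_dist_eq del: One_nat_def)
  obtain f where f: "measurable_partition k M' f" "partition_coords k G' f H"
    using down_setE[OF G' H] .
  define \<eta> where "\<eta> = real k * \<delta> / (1 + real k * \<delta>)"
  have k0: "real k > 0" and kd: "real k * \<delta> > 0" using k \<delta> by auto
  have \<eta>: "0 \<le> \<eta>" "\<eta> \<le> 1" "\<eta> \<le> real k * \<delta>" "1 - \<eta> = 1 / (1 + real k * \<delta>)"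
    using kd by (auto simp: \<eta>_def divide_simps distrib_left)
  have "(1 - \<eta>) * vertex_weight G' f i \<le> 1 / real k" if i: "i \<in> {1..k}" for i
  proof -
    have "\<bar>1 / real k - measure (fst H) {i}\<bar> \<le> (\<Sum>i=1..k. \<bar>1 / real k - measure (fst H) {i}\<bar>)"
      using i by (intro member_le_sum) auto
    also have "\<dots> < \<delta>" using dist by (smt (verit) sum_nonneg abs_ge_zero)
    finally have "vertex_weight G' f i \<le> 1 / real k + \<delta>"
      using f(2) i by (simp add: partition_coords_def)
    then have "(1 - \<eta>) * vertex_weight G' f i \<le> (1 - \<eta>) * (1 / real k + \<delta>)"
      using \<eta>(2) by (intro mult_left_mono) auto
    also have "\<dots> = 1 / real k" using kd k0 unfolding \<eta>(4) by (simp add: divide_simps)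
    finally show ?thesis .
  qed
  then obtain g where g: "measurable_partition k M' g"
    "\<And>i. i \<in> {1..k} \<Longrightarrow> vertex_weight G' g i = 1 / real k"
    "\<And>i x. i \<in> {1..k} \<Longrightarrow> x \<in> space M' \<Longrightarrow> \<bar>f i x - g i x\<bar> \<le> \<eta>"
    using adjust_vertex_weights[OF G' f(1) \<eta>(1,2), of "\<lambda>_. 1 / real k"] k by auto
  obtain \<nu>' where \<nu>': "\<nu>' \<in> uniform_slice k M' G'"
    "\<And>p. p \<in> {1..k} \<times> {1..k} \<Longrightarrow> measure \<nu>' {p} = edge_weight G' g p"
    using partition_imp_uniform_slice[OF G' g(1,2)] by blast
  have "measure_dist k \<nu> \<nu>' \<le>
    (\<Sum>p\<in>{1..k} \<times> {1..k}. \<bar>measure \<nu> {p} - measure (snd H) {p}\<bar> + 2 * (real k * \<delta>) * C)"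
    unfolding measure_dist_eq
  proof (rule sum_mono)
    fix p assume p: "p \<in> {1..k} \<times> {1..k}"
    have "measure (snd H) {p} = edge_weight G' f p"
      using f(2) p unfolding partition_coords_def by blast
    then have "\<bar>measure (snd H) {p} - measure \<nu>' {p}\<bar> \<le> 2 * \<eta> * mass G'"
      using edge_weight_close[OF G' f(1) g(1,3) p] \<nu>'(2)[OF p] by simp
    also have "\<dots> \<le> 2 * (real k * \<delta>) * C"
      using \<eta> C mass_nonneg[of G'] kd by (intro mult_mono) auto
    finally show "\<bar>measure \<nu> {p} - measure \<nu>' {p}\<bar> \<le>
        \<bar>measure \<nu> {p} - measure (snd H) {p}\<bar> + 2 * (real k * \<delta>) * C" by linarith
  qed
  also have "\<dots> < \<delta> + 2 * real k ^ 3 * \<delta> * C"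
  proof -
    have "(\<Sum>i=1..k. \<bar>1 / real k - measure (fst H) {i}\<bar>) \<ge> 0" by (intro sum_nonneg) auto
    then have "(\<Sum>p\<in>{1..k} \<times> {1..k}. \<bar>measure \<nu> {p} - measure (snd H) {p}\<bar>) < \<delta>"
      using dist by linarith
    then show ?thesis
      by (simp add: sum.distrib power3_eq_cube mult_ac del: One_nat_def)
  qed
  finally show "\<exists>\<nu>'\<in>uniform_slice k M' G'. measure_dist k \<nu> \<nu>' < \<delta> + 2 * real k ^ 3 * \<delta> * C"
    using \<nu>'(1) by blast
qed


section \<open>From uniform quotients to all quotients\<close>

text \<open>Round \<open>k ((1 - \<eta>) w\<^sub>i + \<eta>/m)\<close> down to integers and give the remainder to the first one. The
  summand \<open>k \<eta>/m \<ge> 1\<close> compensates for the rounding, so the result still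
  dominates \<open>k (1 - \<eta>) w\<^sub>i\<close> and is positive even where \<open>w\<^sub>i = 0\<close>.\<close>

lemma round_weights:
  fixes w :: "nat \<Rightarrow> real"
  assumes w: "\<And>i. i \<in> {1..m} \<Longrightarrow> 0 \<le> w i" "(\<Sum>i=1..m. w i) = 1" and m: "m \<ge> 1"
    and \<eta>: "\<eta> \<le> 1" and k: "real m \<le> real k * \<eta>"
  obtains a :: "nat \<Rightarrow> nat" where "\<And>i. i \<in> {1..m} \<Longrightarrow> a i \<ge> 1"
    "\<And>i. i \<in> {1..m} \<Longrightarrow> (1 - \<eta>) * w i \<le> real (a i) / real k" "(\<Sum>i=1..m. a i) = k"
proof -
  define t where "t i = real k * ((1 - \<eta>) * w i + \<eta> / real m)" for i
  define b where "b i = nat \<lfloor>t i\<rfloor>" for i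
  have k0: "real k > 0"
  proof (rule ccontr)
    assume "\<not> real k > 0"
    then have "real k = 0" by simp
    then show False using k m by simp
  qed
  have t: "t i \<ge> real k * ((1 - \<eta>) * w i) + 1" and t0: "0 \<le> real k * ((1 - \<eta>) * w i)" if "i \<in> {1..m}" for i
  proof -
    have "1 \<le> real k * \<eta> / real m" using k m by (simp add: divide_simps)
    then show "t i \<ge> real k * ((1 - \<eta>) * w i) + 1" by (simp add: t_def algebra_simps)
    show "0 \<le> real k * ((1 - \<eta>) * w i)" using w(1)[OF that] \<eta> by simp
  qed
  have b: "real (b i) \<ge> real k * ((1 - \<eta>) * w i)" "b i \<ge> 1" "real (b i) \<le> t i" if "i \<in> {1..m}" for i
  proof -
    have "t i \<ge> 1" using t[OF that] t0[OF that] by linarith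
    then have "1 \<le> \<lfloor>t i\<rfloor>" by simp
    then have rb: "real (b i) = of_int \<lfloor>t i\<rfloor>" by (simp add: b_def)
    then show "real (b i) \<ge> real k * ((1 - \<eta>) * w i)" using t[OF that] by linarith
    show "b i \<ge> 1" using \<open>1 \<le> \<lfloor>t i\<rfloor>\<close> unfolding b_def by linarith
    show "real (b i) \<le> t i" using rb by simp
  qed
  have "real (\<Sum>i=1..m. b i) \<le> (\<Sum>i=1..m. t i)"
    unfolding of_nat_sum by (rule sum_mono) (rule b(3))
  also have "\<dots> = real k * ((1 - \<eta>) * (\<Sum>i=1..m. w i) + \<eta>)"
    using m by (simp add: t_def sum_distrib_left[symmetric] sum.distrib)
  also have "\<dots> = real k" using w(2) by simp
  finally have bk: "(\<Sum>i=1..m. b i) \<le> k" by (simp only: of_nat_le_iff)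
  define a where "a i = b i + (if i = 1 then k - (\<Sum>i=1..m. b i) else 0)" for i
  have "(\<Sum>i=1..m. a i) = (\<Sum>i=1..m. b i) + (k - (\<Sum>i=1..m. b i))"
    unfolding a_def sum.distrib using m by (subst sum.delta) auto
  then have "(\<Sum>i=1..m. a i) = k" using bk by simp
  moreover have "a i \<ge> 1" if "i \<in> {1..m}" for i using b(2)[OF that] by (simp add: a_def)
  moreover have "(1 - \<eta>) * w i \<le> real (a i) / real k" if "i \<in> {1..m}" for i
  proof -
    have "real k * ((1 - \<eta>) * w i) \<le> real (a i)" using b(1)[OF that] by (simp add: a_def)
    then show ?thesis using k0 by (simp add: pos_le_divide_eq mult.commute)
  qed
  ultimately show thesis using that by blast
qed

lemma block_map:
  assumes "(\<Sum>i=1..m. a i) = k"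
  obtains \<phi> :: "nat \<Rightarrow> nat" where "\<phi> ` {1..k} \<subseteq> {1..m}"
    "\<And>i. i \<in> {1..m} \<Longrightarrow> card {p \<in> {1..k}. \<phi> p = i} = a i"
proof -
  let ?A = "Sigma {1..m} (\<lambda>i. {..<a i})"
  have "card {1..k} = card ?A" using assms by (subst card_SigmaI) auto
  then obtain h where h: "bij_betw h {1..k} ?A"
    using finite_same_card_bij[of "{1..k}" ?A] by auto
  have "card {p \<in> {1..k}. fst (h p) = i} = a i" if i: "i \<in> {1..m}" for i
  proof -
    have image: "h ` {p \<in> {1..k}. fst (h p) = i} = {i} \<times> {..<a i}"
    proof (intro equalityI subsetI)
      fix z assume z: "z \<in> {i} \<times> {..<a i}"
      then have "z \<in> h ` {1..k}" using h i by (auto simp: bij_betw_def)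
      then obtain p where p: "p \<in> {1..k}" "z = h p" by blast
      moreover from this have "fst (h p) = i" using z by (metis fst_conv mem_Times_iff singletonD)
      ultimately show "z \<in> h ` {p \<in> {1..k}. fst (h p) = i}" by blast
    next
      fix z assume "z \<in> h ` {p \<in> {1..k}. fst (h p) = i}"
      then obtain p where "p \<in> {1..k}" "z = h p" "fst z = i" by blast
      moreover from this have "z \<in> ?A" using h unfolding bij_betw_def by blast
      ultimately show "z \<in> {i} \<times> {..<a i}" by (auto simp: mem_Times_iff)
    qed
    have "inj_on h {p \<in> {1..k}. fst (h p) = i}"
      using h by (auto simp: bij_betw_def intro: inj_on_subset)
    from card_image[OF this] show ?thesis unfolding image by simp
  qed
  moreover have "(\<lambda>p. fst (h p)) ` {1..k} \<subseteq> {1..m}"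
  proof (rule image_subsetI)
    fix p assume "p \<in> {1..k}"
    then have "h p \<in> ?A" using h unfolding bij_betw_def by blast
    then show "fst (h p) \<in> {1..m}" by (metis SigmaE fst_conv)
  qed
  ultimately show thesis using that[of "\<lambda>p. fst (h p)"] by blast
qed

definition merge_parts :: "(nat \<Rightarrow> nat) \<Rightarrow> nat \<Rightarrow> (nat \<Rightarrow> 'a \<Rightarrow> real) \<Rightarrow> nat \<Rightarrow> 'a \<Rightarrow> real" where
  "merge_parts \<phi> k f = (\<lambda>i x. \<Sum>p | p \<in> {1..k} \<and> \<phi> p = i. f p x)"

lemma measurable_partition_merge:
  assumes f: "measurable_partition k M f" and \<phi>: "\<phi> ` {1..k} \<subseteq> {1..m}"
  shows "measurable_partition m M (merge_parts \<phi> k f)"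
  unfolding measurable_partition_def
proof (intro conjI ballI)
  fix i assume "i \<in> {1..m}"
  show "merge_parts \<phi> k f i \<in> borel_measurable M"
    unfolding merge_parts_def using f by (intro borel_measurable_sum) (auto simp: measurable_partition_def)
next
  fix x i assume "x \<in> space M"
  then show "0 \<le> merge_parts \<phi> k f i x"
    unfolding merge_parts_def using measurable_partition_bounds[OF f] by (intro sum_nonneg) auto
next
  fix x assume "x \<in> space M"
  then show "(\<Sum>i=1..m. merge_parts \<phi> k f i x) = 1"
    unfolding merge_parts_def using f by (subst sum.group[OF _ _ \<phi>]) (auto simp: measurable_partition_def)
qed

lemma vertex_weight_merge:
  assumes G: "box_graphon M G" and f: "measurable_partition k M f"
  shows "vertex_weight G (merge_parts \<phi> k f) i = (\<Sum>p | p \<in> {1..k} \<and> \<phi> p = i. vertex_weight G f p)"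
  unfolding vertex_weight_def merge_parts_def
  by (rule Bochner_Integration.integral_sum) (auto intro!: integrable_partition[OF G f] simp del: One_nat_def)

text \<open>Expand the product of the two sums over blocks.\<close>

lemma edge_weight_merge:
  assumes G: "box_graphon M G" and f: "measurable_partition k M f"
  shows "edge_weight G (merge_parts \<phi> k f) P =
    (\<Sum>p | p \<in> {1..k} \<times> {1..k} \<and> map_prod \<phi> \<phi> p = P. edge_weight G f p)"
proof -
  obtain i j where P: "P = (i, j)" by fastforce
  let ?B = "\<lambda>i. {p. p \<in> {1..k} \<and> \<phi> p = i}"
  have B: "{p. p \<in> {1..k} \<times> {1..k} \<and> map_prod \<phi> \<phi> p = P} = ?B i \<times> ?B j" by (auto simp: P)
  have "edge_weight G (merge_parts \<phi> k f) P = (\<integral>z. (\<Sum>p\<in>?B i. f p (fst z)) * (\<Sum>q\<in>?B j. f q (snd z)) \<partial>snd G)"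
    by (simp only: edge_weight_def P prod.case merge_parts_def)
  also have "\<dots> = (\<integral>z. (\<Sum>p\<in>?B i \<times> ?B j. f (fst p) (fst z) * f (snd p) (snd z)) \<partial>snd G)"
    by (simp only: sum_product sum.cartesian_product case_prod_unfold)
  also have "\<dots> = (\<Sum>p\<in>?B i \<times> ?B j. (\<integral>z. f (fst p) (fst z) * f (snd p) (snd z) \<partial>snd G))"
    by (rule Bochner_Integration.integral_sum) (auto intro!: integrable_partition_square[OF G f _ f] simp del: One_nat_def)
  finally show ?thesis by (simp only: B edge_weight_def case_prod_unfold)
qed

lemma edge_weight_cong:
  assumes fg: "\<And>i x. i \<in> {1..k} \<Longrightarrow> f i x = g i x"
    and p: "p \<in> {1..k} \<times> {1..k}"
  shows "edge_weight G f p = edge_weight G g p"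
proof -
  obtain i j where "p = (i, j)" "i \<in> {1..k}" "j \<in> {1..k}" using p by blast
  then show ?thesis by (simp only: edge_weight_def prod.case fg)
qed

text \<open>The three terms of the bound are the change of the vertex weights by mixing, the change of the
  edge weights by mixing, and the \<open>\<ell>\<^sup>1\<close>-distance \<open>\<delta>\<close> of the two uniform quotients, which
  merging does not increase. Positivity of the block sizes \<open>a\<^sub>i\<close> is what allows to divide by them:
  parts without \<open>\<pi>\<close>-weight may still carry edge weight and cannot be dropped.\<close>

lemma near_down_set:
  assumes G: "box_graphon M G" and G': "box_graphon M' G'" and m: "m \<ge> 1"
    and \<eta>: "0 < \<eta>" "\<eta> \<le> 1" and k: "real m \<le> real k * \<eta>" and C: "mass G \<le> C"
    and near: "near (measure_dist k) \<delta> (uniform_slice k M G) (uniform_slice k M' G')"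
  shows "near (graphon_dist m) (real m * \<eta> + 2 * real m ^ 2 * \<eta> * C + \<delta>) (down_set m M G) (down_set m M' G')"
  unfolding near_def
proof
  fix H assume "H \<in> down_set m M G"
  then obtain f where f: "measurable_partition m M f" "partition_coords m G f H"
    using down_setE[OF G] by blast
  obtain a :: "nat \<Rightarrow> nat" where a: "\<And>i. i \<in> {1..m} \<Longrightarrow> a i \<ge> 1"
    "\<And>i. i \<in> {1..m} \<Longrightarrow> (1 - \<eta>) * vertex_weight G f i \<le> real (a i) / real k" "(\<Sum>i=1..m. a i) = k"
    using round_weights[of m "vertex_weight G f" \<eta> k] vertex_weight_nonneg[OF G f(1)]
      sum_vertex_weight[OF G f(1)] m \<eta>(2) k by metis
  have k0: "real k > 0"
    using k m \<eta> by (cases "k = 0") auto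
  have "(\<Sum>i=1..m. real (a i) / real k) = 1"
    using a(3) k0 by (simp add: sum_divide_distrib[symmetric] flip: of_nat_sum)
  then obtain g where g: "measurable_partition m M g"
    "\<And>i. i \<in> {1..m} \<Longrightarrow> vertex_weight G g i = real (a i) / real k"
    "\<And>i x. i \<in> {1..m} \<Longrightarrow> x \<in> space M \<Longrightarrow> \<bar>f i x - g i x\<bar> \<le> \<eta>"
    using adjust_vertex_weights[OF G f(1) less_imp_le[OF \<eta>(1)] \<eta>(2) a(2)] by metis
  obtain \<phi> where \<phi>: "\<phi> ` {1..k} \<subseteq> {1..m}" "\<And>i. i \<in> {1..m} \<Longrightarrow> card {p \<in> {1..k}. \<phi> p = i} = a i"
    using block_map[OF a(3)] by blast
  have \<phi>m: "\<phi> p \<in> {1..m}" if "p \<in> {1..k}" for p using \<phi>(1) that by blast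
  \<comment> \<open>Split the \<open>i\<close>-th function evenly over the block of \<open>i\<close>, which has \<open>a i\<close> elements.\<close>
  define h where "h p x = g (\<phi> p) x / real (a (\<phi> p))" for p x
  have merge_h: "merge_parts \<phi> k h i x = g i x" if "i \<in> {1..m}" for i x
  proof -
    have "merge_parts \<phi> k h i x = (\<Sum>p | p \<in> {1..k} \<and> \<phi> p = i. g i x / real (a i))"
      unfolding merge_parts_def h_def by (intro sum.cong) auto
    also have "\<dots> = g i x" using \<phi>(2)[OF that] a(1)[OF that] by simp
    finally show ?thesis .
  qed
  have h: "measurable_partition k M h"
    unfolding measurable_partition_def
  proof (intro conjI ballI)
    fix p assume "p \<in> {1..k}"
    then have [measurable]: "g (\<phi> p) \<in> borel_measurable M"
      using g(1) \<phi>m by (simp add: measurable_partition_def)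
    show "h p \<in> borel_measurable M" unfolding h_def by measurable
  next
    fix x p assume "x \<in> space M" "p \<in> {1..k}"
    then show "0 \<le> h p x"
      using measurable_partition_bounds(1)[OF g(1) _ \<phi>m] by (simp add: h_def)
  next
    fix x assume x: "x \<in> space M"
    have "(\<Sum>p=1..k. h p x) = (\<Sum>i=1..m. merge_parts \<phi> k h i x)"
      unfolding merge_parts_def by (subst sum.group[OF _ _ \<phi>(1)]) auto
    also have "\<dots> = (\<Sum>i=1..m. g i x)" using merge_h by (intro sum.cong) auto
    also have "\<dots> = 1" using g(1) x by (simp add: measurable_partition_def)
    finally show "(\<Sum>p=1..k. h p x) = 1" .
  qed
  have h_uniform: "vertex_weight G h p = 1 / real k" if "p \<in> {1..k}" for p
  proof -
    have "vertex_weight G h p = vertex_weight G g (\<phi> p) / real (a (\<phi> p))"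
      by (simp add: vertex_weight_def h_def)
    then show ?thesis using g(2)[OF \<phi>m[OF that]] a(1)[OF \<phi>m[OF that]] by simp
  qed
  obtain \<nu> where \<nu>: "\<nu> \<in> uniform_slice k M G"
    "\<And>p. p \<in> {1..k} \<times> {1..k} \<Longrightarrow> measure \<nu> {p} = edge_weight G h p"
    using partition_imp_uniform_slice[OF G h h_uniform] by blast
  then obtain \<nu>' where \<nu>': "\<nu>' \<in> uniform_slice k M' G'" "measure_dist k \<nu> \<nu>' < \<delta>"
    using near nearD by metis
  obtain h' where h': "measurable_partition k M' h'" "\<And>i. i \<in> {1..k} \<Longrightarrow> vertex_weight G' h' i = 1 / real k"
    "\<And>p. p \<in> {1..k} \<times> {1..k} \<Longrightarrow> measure \<nu>' {p} = edge_weight G' h' p"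
    using uniform_slice_imp_partition[OF G' \<nu>'(1)] by blast
  let ?g' = "merge_parts \<phi> k h'"
  have g': "measurable_partition m M' ?g'" by (rule measurable_partition_merge[OF h'(1) \<phi>(1)])
  obtain H' where H': "H' \<in> down_set m M' G'" "partition_coords m G' ?g' H'"
    using partition_imp_down_set[OF G' g'] by blast
  have vw: "vertex_weight G' ?g' i = vertex_weight G g i" if "i \<in> {1..m}" for i
  proof -
    have "vertex_weight G' ?g' i = (\<Sum>p | p \<in> {1..k} \<and> \<phi> p = i. 1 / real k)"
      unfolding vertex_weight_merge[OF G' h'(1)] using h'(2) by (intro sum.cong) auto
    also have "\<dots> = real (a i) / real k" using \<phi>(2)[OF that] by simp
    finally show ?thesis using g(2)[OF that] by simp
  qed
  have v: "(\<Sum>i=1..m. \<bar>measure (fst H) {i} - measure (fst H') {i}\<bar>) \<le> real m * \<eta>"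
  proof -
    have "(\<Sum>i=1..m. \<bar>measure (fst H) {i} - measure (fst H') {i}\<bar>) \<le> (\<Sum>i=1..m. \<eta>)"
    proof (rule sum_mono)
      fix i assume i: "i \<in> {1..m}"
      then show "\<bar>measure (fst H) {i} - measure (fst H') {i}\<bar> \<le> \<eta>"
        using f(2) H'(2) vw[OF i] vertex_weight_close[OF G f(1) g(1,3) i]
        by (simp add: partition_coords_def)
    qed
    then show ?thesis by simp
  qed
  have e1: "(\<Sum>P\<in>{1..m} \<times> {1..m}. \<bar>edge_weight G f P - edge_weight G g P\<bar>) \<le> 2 * real m ^ 2 * \<eta> * C"
  proof -
    have "(\<Sum>P\<in>{1..m} \<times> {1..m}. \<bar>edge_weight G f P - edge_weight G g P\<bar>) \<le>
        (\<Sum>P\<in>{1..m} \<times> {1..m}. 2 * \<eta> * C)"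
    proof (rule sum_mono)
      fix P assume P: "P \<in> {1..m} \<times> {1..m}"
      have "\<bar>edge_weight G f P - edge_weight G g P\<bar> \<le> 2 * \<eta> * mass G"
        by (rule edge_weight_close[OF G f(1) g(1,3) P])
      also have "\<dots> \<le> 2 * \<eta> * C" using C \<eta> by (intro mult_left_mono) auto
      finally show "\<bar>edge_weight G f P - edge_weight G g P\<bar> \<le> 2 * \<eta> * C" .
    qed
    then show ?thesis by (simp add: power2_eq_square mult_ac)
  qed
  have e2: "(\<Sum>P\<in>{1..m} \<times> {1..m}. \<bar>edge_weight G g P - edge_weight G' ?g' P\<bar>) < \<delta>"
  proof -
    \<comment> \<open>Both edge weights are sums over the pairs of the block of \<open>P\<close>, and these blocks partition all pairs.\<close>
    let ?B = "\<lambda>P. {p. p \<in> {1..k} \<times> {1..k} \<and> map_prod \<phi> \<phi> p = P}"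
    have "\<bar>edge_weight G g P - edge_weight G' ?g' P\<bar> \<le> (\<Sum>p\<in>?B P. \<bar>measure \<nu> {p} - measure \<nu>' {p}\<bar>)"
      if P: "P \<in> {1..m} \<times> {1..m}" for P
    proof -
      have "edge_weight G g P = edge_weight G (merge_parts \<phi> k h) P"
        using edge_weight_cong[OF _ P] merge_h by metis
      then have "edge_weight G g P = (\<Sum>p\<in>?B P. measure \<nu> {p})"
        unfolding edge_weight_merge[OF G h] using \<nu>(2) by simp
      moreover have "edge_weight G' ?g' P = (\<Sum>p\<in>?B P. measure \<nu>' {p})"
        unfolding edge_weight_merge[OF G' h'(1)] using h'(3) by simp
      ultimately show ?thesis by (simp only: sum_subtractf[symmetric] sum_abs)
    qed
    then have "(\<Sum>P\<in>{1..m} \<times> {1..m}. \<bar>edge_weight G g P - edge_weight G' ?g' P\<bar>) \<le>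
        (\<Sum>P\<in>{1..m} \<times> {1..m}. \<Sum>p\<in>?B P. \<bar>measure \<nu> {p} - measure \<nu>' {p}\<bar>)"
      by (rule sum_mono)
    also have "\<dots> = measure_dist k \<nu> \<nu>'"
      unfolding measure_dist_eq using \<phi>(1) by (intro sum.group) auto
    finally show ?thesis using \<nu>'(2) by simp
  qed
  have "(\<Sum>P\<in>{1..m} \<times> {1..m}. \<bar>measure (snd H) {P} - measure (snd H') {P}\<bar>) \<le>
      (\<Sum>P\<in>{1..m} \<times> {1..m}. \<bar>edge_weight G f P - edge_weight G g P\<bar> + \<bar>edge_weight G g P - edge_weight G' ?g' P\<bar>)"
  proof (rule sum_mono)
    fix P assume P: "P \<in> {1..m} \<times> {1..m}"
    have "measure (snd H) {P} = edge_weight G f P" "measure (snd H') {P} = edge_weight G' ?g' P"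
      using f(2) H'(2) P unfolding partition_coords_def by blast+
    then show "\<bar>measure (snd H) {P} - measure (snd H') {P}\<bar> \<le>
      \<bar>edge_weight G f P - edge_weight G g P\<bar> + \<bar>edge_weight G g P - edge_weight G' ?g' P\<bar>" by linarith
  qed
  then have "graphon_dist m H H' < real m * \<eta> + 2 * real m ^ 2 * \<eta> * C + \<delta>"
    unfolding graphon_dist_eq using v e1 e2 by (simp add: sum.distrib)
  then show "\<exists>H'\<in>down_set m M' G'. graphon_dist m H H' < real m * \<eta> + 2 * real m ^ 2 * \<eta> * C + \<delta>"
    using H'(1) by blast
qed

section \<open>Equivalence of the two kinds of convergence\<close>

lemma mass_close_if_near_down_sets:
  assumes G: "box_graphon M G" and G': "box_graphon M' G'" and k: "k \<ge> 1"
    and near: "near (graphon_dist k) \<delta> (down_set k M G) (down_set k M' G')"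
  shows "\<bar>mass G - mass G'\<bar> < \<delta>"
proof -
  obtain H where H: "H \<in> down_set k M G" using down_set_nonempty[OF G k] by blast
  then obtain H' where H': "H' \<in> down_set k M' G'" "graphon_dist k H H' < \<delta>"
    using near nearD by metis
  have "mass G - mass G' = (\<Sum>p\<in>{1..k} \<times> {1..k}. measure (snd H) {p} - measure (snd H') {p})"
    using sum_down_set(2)[OF G H] sum_down_set(2)[OF G' H'(1)] by (simp add: sum_subtractf)
  also have "\<bar>\<dots>\<bar> \<le> (\<Sum>p\<in>{1..k} \<times> {1..k}. \<bar>measure (snd H) {p} - measure (snd H') {p}\<bar>)"
    by (rule sum_abs)
  also have "\<dots> \<le> graphon_dist k H H'"
    unfolding graphon_dist_eq by (simp add: sum_nonneg)
  finally show ?thesis using H'(2) by simp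
qed

lemma mass_close_if_near_uniform_slices:
  assumes G: "box_graphon M G" and G': "box_graphon M' G'" and k: "k \<ge> 1"
    and near: "near (measure_dist k) \<delta> (uniform_slice k M G) (uniform_slice k M' G')"
  shows "\<bar>mass G - mass G'\<bar> < \<delta>"
proof -
  obtain \<nu> where \<nu>: "\<nu> \<in> uniform_slice k M G" using uniform_slice_nonempty[OF G k] by blast
  then obtain \<nu>' where \<nu>': "\<nu>' \<in> uniform_slice k M' G'" "measure_dist k \<nu> \<nu>' < \<delta>"
    using near nearD by metis
  have "mass G - mass G' = (\<Sum>p\<in>{1..k} \<times> {1..k}. measure \<nu> {p} - measure \<nu>' {p})"
    using sum_uniform_slice[OF G \<nu>] sum_uniform_slice[OF G' \<nu>'(1)] by (simp add: sum_subtractf)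
  also have "\<bar>\<dots>\<bar> \<le> measure_dist k \<nu> \<nu>'"
    unfolding measure_dist_eq by (rule sum_abs)
  finally show ?thesis using \<nu>'(2) by simp
qed

text \<open>The filter lets one statement serve twice: with one index for convergence to a given limit, and
  with pairs of indices for the Cauchy property. Either side of the equivalence bounds the
  difference of the masses, but the moduli need the masses themselves to be bounded, which is the
  remaining hypothesis.\<close>

lemma eventually_close_iff:
  fixes G :: "'z \<Rightarrow> 'a graphon" and G' :: "'z \<Rightarrow> 'b graphon"
  assumes G: "\<And>z. box_graphon (M z) (G z)" and G': "\<And>z. box_graphon (M' z) (G' z)"
    and bounded: "\<forall>\<^sub>F z in F. \<bar>mass (G z) - mass (G' z)\<bar> < 1 \<Longrightarrow>
      \<exists>C. \<forall>\<^sub>F z in F. mass (G z) \<le> C \<and> mass (G' z) \<le> C"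
  shows "(\<forall>k\<ge>1. \<forall>\<epsilon>>0. \<forall>\<^sub>F z in F.
        hausdorff_close (graphon_dist k) \<epsilon> (down_set k (M z) (G z)) (down_set k (M' z) (G' z))) \<longleftrightarrow>
    (\<forall>k\<ge>1. \<forall>\<epsilon>>0. \<forall>\<^sub>F z in F.
        hausdorff_close (measure_dist k) \<epsilon> (uniform_slice k (M z) (G z)) (uniform_slice k (M' z) (G' z)))"
    (is "?down \<longleftrightarrow> ?slice")
proof
  assume down: ?down
  have "\<forall>\<^sub>F z in F. \<bar>mass (G z) - mass (G' z)\<bar> < 1"
    using down[rule_format, OF order_refl zero_less_one]
    by (rule eventually_mono) (auto simp: hausdorff_close_def intro: mass_close_if_near_down_sets[OF G G' order_refl])
  from bounded[OF this] obtain C0 where "\<forall>\<^sub>F z in F. mass (G z) \<le> C0 \<and> mass (G' z) \<le> C0" by blast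
  then have C: "\<forall>\<^sub>F z in F. mass (G z) \<le> max 0 C0 \<and> mass (G' z) \<le> max 0 C0"
    by (rule eventually_mono) auto
  define C where "C = max 0 C0"
  have C0: "0 \<le> C" by (simp add: C_def)
  show ?slice
  proof (intro allI impI)
    fix k :: nat and \<epsilon> :: real assume k: "k \<ge> 1" and \<epsilon>: "\<epsilon> > 0"
    define \<delta> where "\<delta> = \<epsilon> / (1 + 2 * real k ^ 3 * C)"
    have pos: "1 + 2 * real k ^ 3 * C > 0" using C0 by (simp add: add_pos_nonneg)
    then have \<delta>: "\<delta> > 0" using \<epsilon> by (simp add: \<delta>_def)
    have "\<delta> * (1 + 2 * real k ^ 3 * C) = \<epsilon>" using pos by (simp add: \<delta>_def)
    then have \<delta>\<epsilon>: "\<delta> + 2 * real k ^ 3 * \<delta> * C = \<epsilon>" by (simp add: algebra_simps)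
    show "\<forall>\<^sub>F z in F. hausdorff_close (measure_dist k) \<epsilon> (uniform_slice k (M z) (G z)) (uniform_slice k (M' z) (G' z))"
      using down[rule_format, OF k \<delta>] C[folded C_def]
    proof eventually_elim
      case (elim z)
      then show ?case
        using near_uniform_slice[OF G G' k \<delta>] near_uniform_slice[OF G' G k \<delta>]
        unfolding hausdorff_close_def \<delta>\<epsilon>[symmetric] by blast
    qed
  qed
next
  assume slice: ?slice
  have "\<forall>\<^sub>F z in F. \<bar>mass (G z) - mass (G' z)\<bar> < 1"
    using slice[rule_format, OF order_refl zero_less_one]
    by (rule eventually_mono) (auto simp: hausdorff_close_def intro: mass_close_if_near_uniform_slices[OF G G' order_refl])
  from bounded[OF this] obtain C0 where "\<forall>\<^sub>F z in F. mass (G z) \<le> C0 \<and> mass (G' z) \<le> C0" by blast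
  then have C: "\<forall>\<^sub>F z in F. mass (G z) \<le> max 0 C0 \<and> mass (G' z) \<le> max 0 C0"
    by (rule eventually_mono) auto
  define C where "C = max 0 C0"
  have C0: "0 \<le> C" by (simp add: C_def)
  show ?down
  proof (intro allI impI)
    fix m :: nat and \<epsilon> :: real assume m: "m \<ge> 1" and \<epsilon>: "\<epsilon> > 0"
    define A where "A = real m + 2 * real m ^ 2 * C"
    have A: "A > 0" using m C0 by (simp add: A_def add_pos_nonneg)
    \<comment> \<open>With this \<open>\<eta>\<close> the mixing terms of the estimate take at most half of \<open>\<epsilon>\<close>.\<close>
    define \<eta> where "\<eta> = min 1 (\<epsilon> / 2 / A)"
    have \<eta>: "0 < \<eta>" "\<eta> \<le> 1" using A \<epsilon> by (auto simp: \<eta>_def)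
    have "\<eta> * A \<le> \<epsilon> / 2 / A * A" unfolding \<eta>_def using A by (intro mult_right_mono) auto
    also have "\<dots> = \<epsilon> / 2" using A by simp
    finally have \<eta>A: "real m * \<eta> + 2 * real m ^ 2 * \<eta> * C + \<epsilon> / 2 \<le> \<epsilon>"
      by (simp add: A_def algebra_simps)
    obtain k :: nat where "real m / \<eta> \<le> real k" using real_arch_simple by blast
    then have k: "real m \<le> real k * \<eta>" using \<eta> by (simp add: pos_divide_le_eq)
    have "k \<noteq> 0" using k m by (cases "k = 0") auto
    then have k1: "k \<ge> 1" by simp
    have "\<epsilon> / 2 > 0" using \<epsilon> by simp
    from slice[rule_format, OF k1 this] C[folded C_def]
    show "\<forall>\<^sub>F z in F. hausdorff_close (graphon_dist m) \<epsilon> (down_set m (M z) (G z)) (down_set m (M' z) (G' z))"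
    proof eventually_elim
      case (elim z)
      then have "hausdorff_close (graphon_dist m) (real m * \<eta> + 2 * real m ^ 2 * \<eta> * C + \<epsilon> / 2)
          (down_set m (M z) (G z)) (down_set m (M' z) (G' z))"
        using near_down_set[OF G G' m \<eta> k] near_down_set[OF G' G m \<eta> k]
        unfolding hausdorff_close_def by blast
      then show ?case using hausdorff_close_mono \<eta>A by blast
    qed
  qed
qed

lemma limitin_S_set_iff:
  assumes "\<And>n. box_graphon (M n) (G n)" "box_graphon M' G'" "k \<ge> 1"
  shows "limitin (vietoris (graphon_topology k)) (\<lambda>n. S_set k (M n) (G n)) (S_set k M' G') sequentially \<longleftrightarrow>
    (\<forall>\<epsilon>>0. \<forall>\<^sub>F n in sequentially.
        hausdorff_close (graphon_dist k) \<epsilon> (down_set k (M n) (G n)) (down_set k M' G'))"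
  using assms S_set_compact[OF assms(1,3)] S_set_compact[OF assms(2,3)]
  unfolding S_set_def mtopology_graphons[symmetric]
  by (intro graphons.limitin_vietoris_closures_iff down_set_subset)

lemma limitin_S_tilde_set_iff:
  assumes "\<And>n. box_graphon (M n) (G n)" "box_graphon M' G'" "k \<ge> 1"
  shows "limitin (vietoris (measure_topology k)) (\<lambda>n. S_tilde_set k (M n) (G n)) (S_tilde_set k M' G') sequentially \<longleftrightarrow>
    (\<forall>\<epsilon>>0. \<forall>\<^sub>F n in sequentially.
        hausdorff_close (measure_dist k) \<epsilon> (uniform_slice k (M n) (G n)) (uniform_slice k M' G'))"
  using assms S_tilde_set_compact[OF assms(1,3)] S_tilde_set_compact[OF assms(2,3)]
  unfolding S_tilde_set_def uniform_slice_def[symmetric] mtopology_measures[symmetric]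
  by (intro measures.limitin_vietoris_closures_iff uniform_slice_subset)

lemma vietoris_convergent_S_set_iff:
  assumes "\<And>n. box_graphon (M n) (G n)" "k \<ge> 1"
  shows "vietoris_convergent (graphon_topology k) (\<lambda>n. S_set k (M n) (G n)) \<longleftrightarrow>
    (\<forall>\<epsilon>>0. \<forall>\<^sub>F z in sequentially \<times>\<^sub>F sequentially. hausdorff_close (graphon_dist k) \<epsilon>
        (down_set k (M (fst z)) (G (fst z))) (down_set k (M (snd z)) (G (snd z))))"
  using S_set_compact[OF assms] compactin_mcball_graphons[of k]
  unfolding S_set_def mtopology_graphons[symmetric] eventually_prod_sequentially fst_conv snd_conv
  by (subst graphons.vietoris_convergent_closures_iff) (auto simp: down_set_subset graphons.hausdorff_close_commute)

lemma vietoris_convergent_S_tilde_set_iff: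
  assumes "\<And>n. box_graphon (M n) (G n)" "k \<ge> 1"
  shows "vietoris_convergent (measure_topology k) (\<lambda>n. S_tilde_set k (M n) (G n)) \<longleftrightarrow>
    (\<forall>\<epsilon>>0. \<forall>\<^sub>F z in sequentially \<times>\<^sub>F sequentially. hausdorff_close (measure_dist k) \<epsilon>
        (uniform_slice k (M (fst z)) (G (fst z))) (uniform_slice k (M (snd z)) (G (snd z))))"
  using S_tilde_set_compact[OF assms] compactin_mcball_measures[of k]
  unfolding S_tilde_set_def uniform_slice_def[symmetric] mtopology_measures[symmetric]
    eventually_prod_sequentially fst_conv snd_conv
  by (subst measures.vietoris_convergent_closures_iff) (auto simp: uniform_slice_subset measures.hausdorff_close_commute)

theorem theorem5p5:
  fixes X\<^sub>n :: "nat \<Rightarrow> 'a measure" and G\<^sub>n :: "nat \<Rightarrow> 'a graphon"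
    and X :: "'b measure" and G :: "'b graphon"
  assumes "\<And>n. box_graphon (X\<^sub>n n) (G\<^sub>n n)"
    and "box_graphon X G"
  shows
    "((\<forall>k\<ge>1. vietoris_convergent (graphon_topology k) (\<lambda>n. S_set k (X\<^sub>n n) (G\<^sub>n n))) \<longleftrightarrow>
      (\<forall>k\<ge>1. vietoris_convergent (measure_topology k) (\<lambda>n. S_tilde_set k (X\<^sub>n n) (G\<^sub>n n)))) \<and>
     ((\<forall>k\<ge>1. limitin (vietoris (graphon_topology k))
                (\<lambda>n. S_set k (X\<^sub>n n) (G\<^sub>n n)) (S_set k X G) sequentially) \<longleftrightarrow>
      (\<forall>k\<ge>1. limitin (vietoris (measure_topology k))
                (\<lambda>n. S_tilde_set k (X\<^sub>n n) (G\<^sub>n n)) (S_tilde_set k X G) sequentially))"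
proof
  have "\<exists>C. \<forall>\<^sub>F z in sequentially \<times>\<^sub>F sequentially. mass (G\<^sub>n (fst z)) \<le> C \<and> mass (G\<^sub>n (snd z)) \<le> C"
    if bd: "\<forall>\<^sub>F z in sequentially \<times>\<^sub>F sequentially. \<bar>mass (G\<^sub>n (fst z)) - mass (G\<^sub>n (snd z))\<bar> < 1"
  proof -
    obtain N where N: "\<forall>m\<ge>N. \<forall>n\<ge>N. \<bar>mass (G\<^sub>n n) - mass (G\<^sub>n m)\<bar> < 1"
      using bd unfolding eventually_prod_sequentially fst_conv snd_conv by blast
    have "mass (G\<^sub>n n) \<le> mass (G\<^sub>n N) + 1" if "n \<ge> N" for n
      using N[rule_format, OF order_refl that] by linarith
    then show ?thesis
      by (intro exI[of _ "mass (G\<^sub>n N) + 1"]) (auto simp: eventually_prod_sequentially)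
  qed
  note eventually_close_iff[OF assms(1) assms(1), OF this]
  then show "(\<forall>k\<ge>1. vietoris_convergent (graphon_topology k) (\<lambda>n. S_set k (X\<^sub>n n) (G\<^sub>n n))) \<longleftrightarrow>
      (\<forall>k\<ge>1. vietoris_convergent (measure_topology k) (\<lambda>n. S_tilde_set k (X\<^sub>n n) (G\<^sub>n n)))"
    by (simp only: vietoris_convergent_S_set_iff[OF assms(1)]
        vietoris_convergent_S_tilde_set_iff[OF assms(1)] cong: imp_cong)
next
  have "\<exists>C. \<forall>\<^sub>F n in sequentially. mass (G\<^sub>n n) \<le> C \<and> mass G \<le> C"
    if "\<forall>\<^sub>F n in sequentially. \<bar>mass (G\<^sub>n n) - mass G\<bar> < 1"
    using that by (intro exI[of _ "mass G + 1"]) (auto elim: eventually_mono)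
  note eventually_close_iff[OF assms, OF this]
  then show "(\<forall>k\<ge>1. limitin (vietoris (graphon_topology k))
                (\<lambda>n. S_set k (X\<^sub>n n) (G\<^sub>n n)) (S_set k X G) sequentially) \<longleftrightarrow>
      (\<forall>k\<ge>1. limitin (vietoris (measure_topology k))
                (\<lambda>n. S_tilde_set k (X\<^sub>n n) (G\<^sub>n n)) (S_tilde_set k X G) sequentially)"
    by (simp only: limitin_S_set_iff[OF assms] limitin_S_tilde_set_iff[OF assms] cong: imp_cong)
qed

end
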